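(* Let $\Gamma\subset\mathbb{R}^n$ be the attractor of an iterated function system of contracting similarities satisfying the open set condition, and let $\mu$ be an invariant measure on $\Gamma$. Let $h>0$, let $L_h(\Gamma)$ be the index set defined in the context, and let $\Gamma_{\mathrm{Hull},h}:=\bigcup_{\boldsymbol m\in L_h(\Gamma)}\mathrm{Hull}(\Gamma_{\boldsymbol m})$. Let $f:\Gamma_{\mathrm{Hull},h}\to\mathbb{C}$ be a function whose restriction to $\Gamma$ is continuous, and let $E:=|I_\Gamma[f]-Q^h_\Gamma[f]|$, where $I_\Gamma[f]=\int_\Gamma f\,d\mu$ and $Q_\Gamma^h[f]=\sum_{\boldsymbol m\in L_h(\Gamma)}\mu(\Gamma_{\boldsymbol m})f(x_{\boldsymbol m})$ is the barycentre rule. Then: (i) $E\le h\,\mu(\Gamma)\max_{\boldsymbol m\in L_h(\Gamma)}\mathcal{L}_{0,\mathrm{Hull}(\Gamma_{\boldsymbol m})}[f]$. (ii) If $f$ is differentiable in an open set $\Omega\supset\Gamma_{\mathrm{Hull},h}$ then $$E\le h\,\mu(\Gamma)\sup_{x\in\Gamma_{\mathrm{Hull},h}}|\nabla f(x)|\le\sqrt n\,h\,\mu(\Gamma)\sup_{x\in\Gamma_{\mathrm{Hull},h}}\max_{\alpha\in\mathbb{N}_0^n,\,|\alpha|=1}|D^\alpha f(x)|$$ and $$E\le h^2\mu(\Gamma)\max_{\boldsymbol m\in L_h(\Gamma)}\mathcal{L}_{1,\mathrm{Hull}(\Gamma_{\boldsymbol m})}[f].$$ (iii) If $f$ is twice differentiable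 in an open set $\Omega\supset\Gamma_{\mathrm{Hull},h}$ then $$E\le\frac{h^2}{2}\mu(\Gamma)\sup_{x\in\Gamma_{\mathrm{Hull},h}}\|Hf(x)\|_2\le\frac{nh^2}{2}\mu(\Gamma)\sup_{x\in\Gamma_{\mathrm{Hull},h}}\max_{\alpha\in\mathbb{N}_0^n,\,|\alpha|=2}|D^\alpha f(x)|.$$
   Context: IFS: a collection $\{s_1,\dots,s_M\}$, $M\ge2$, of maps $s_m:\mathbb{R}^n\to\mathbb{R}^n$, $s_m(x)=\rho_mA_mx+\delta_m$, with $\rho_m\in(0,1)$, $A_m$ an orthogonal $n\times n$ matrix, $\delta_m\in\mathbb{R}^n$. Its attractor $\Gamma$ is the unique non-empty compact set with $\Gamma=\bigcup_{m=1}^Ms_m(\Gamma)$. Open set condition: there is a non-empty bounded open set $O\subset\mathbb{R}^n$ with $\bigcup_ms_m(O)\subset O$ and $s_m(O)\cap s_{m'}(O)=\emptyset$ for $m\ne m'$. Invariant measure: given $p_m\in(0,1)$, $m=1,\dots,M$, with $\sum_mp_m=1$, an invariant measure $\mu$ on $\Gamma$ is a non-zero finite Borel regular measure supported on $\Gamma$ such that $\mu(A)=\sum_{m=1}^Mp_m\mu(s_m^{-1}(A))$ for every measurable $A\subset\mathbb{R}^n$ (unique up to normalisation). Vector indices: $I_\ell:=\{1,\dots,M\}^\ell$ for $\ell\in\mathbb{N}=\{1,2,\ldots\}$; for $\boldsymbol m=(m_1,\dots,m_\ell)\in I_\ell$, $s_{\boldsymbol m}:=s_{m_1}\circ\dots\circ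 s_{m_\ell}$ and $\Gamma_{\boldsymbol m}:=s_{\boldsymbol m}(\Gamma)$; also $\Gamma_0:=\Gamma$. For $0<h<\mathrm{diam}(\Gamma)$, $L_h(\Gamma)$ is the set of all $\boldsymbol m=(m_1,\dots,m_\ell)\in\bigcup_{\ell'\in\mathbb{N}}I_{\ell'}$ with $\mathrm{diam}(\Gamma_{\boldsymbol m})\le h$ and $\mathrm{diam}(\Gamma_{(m_1,\dots,m_{\ell-1})})>h$ (with $\Gamma_{(m_1,\dots,m_{\ell-1})}$ replaced by $\Gamma$ if $\ell=1$); for $h\ge\mathrm{diam}(\Gamma)$, $L_h(\Gamma):=\{0\}$. $x_{\boldsymbol m}:=\int_{\Gamma_{\boldsymbol m}}x\,d\mu(x)/\mu(\Gamma_{\boldsymbol m})$ is the barycentre of $\Gamma_{\boldsymbol m}$. $\mathrm{Hull}(E)$ is the convex hull of $E$. For a set $E$, $\mathcal{L}_{0,E}[f]:=\sup_{x\ne y\in E}\frac{|f(x)-f(y)|}{|x-y|}$ and $\mathcal{L}_{1,E}[f]:=\sup_{x\ne y\in E}\frac{|\nabla f(x)-\nabla f(y)|}{|x-y|}$ (values $+\infty$ allowed). $\nabla f$ is the gradient ($\mathbb{C}^n$-valued), $Hf$ the Hessian, $\|\cdot\|_2$ the matrix norm induced by the Euclidean norm, and $D^\alpha$ the partial derivative of multi-index $\alpha$. *)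

theory Defs
  imports "HOL-Analysis.Analysis"
begin

definition similarity_ifs :: "nat \<Rightarrow> (nat \<Rightarrow> real^'n \<Rightarrow> real^'n) \<Rightarrow> bool" where
  "similarity_ifs M s \<longleftrightarrow> M \<ge> 2 \<and>
     (\<forall>m\<in>{1..M}. \<exists>(\<rho>::real) (A::real^'n^'n) (\<delta>::real^'n).
        0 < \<rho> \<and> \<rho> < 1 \<and> orthogonal_matrix A \<and> (\<forall>x. s m x = \<rho> *\<^sub>R (A *v x) + \<delta>))"

definition is_attractor :: "nat \<Rightarrow> (nat \<Rightarrow> real^'n \<Rightarrow> real^'n) \<Rightarrow> (real^'n) set \<Rightarrow> bool" where
  "is_attractor M s \<Gamma> \<longleftrightarrow> compact \<Gamma> \<and> \<Gamma> \<noteq> {} \<and> \<Gamma> = (\<Union>m\<in>{1..M}. s m ` \<Gamma>)"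

definition open_set_condition :: "nat \<Rightarrow> (nat \<Rightarrow> real^'n \<Rightarrow> real^'n) \<Rightarrow> bool" where
  "open_set_condition M s \<longleftrightarrow>
     (\<exists>U. open U \<and> bounded U \<and> U \<noteq> {} \<and> (\<Union>m\<in>{1..M}. s m ` U) \<subseteq> U \<and>
          (\<forall>m\<in>{1..M}. \<forall>m'\<in>{1..M}. m \<noteq> m' \<longrightarrow> s m ` U \<inter> s m' ` U = {}))"

text \<open>Regularity is not listed among the conditions below: every finite measure on the
  Borel sets of Euclidean space is regular (theorems \<open>inner_regular\<close> and \<open>outer_regular\<close> of
  \<^theory>\<open>HOL-Analysis.Regularity\<close>).\<close>

definition invariant_measure ::
  "nat \<Rightarrow> (nat \<Rightarrow> real^'n \<Rightarrow> real^'n) \<Rightarrow> (nat \<Rightarrow> real) \<Rightarrow> (real^'n) set \<Rightarrow> (real^'n) measure \<Rightarrow> bool" where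
  "invariant_measure M s p \<Gamma> \<mu> \<longleftrightarrow>
     sets \<mu> = sets borel \<and> finite_measure \<mu> \<and> emeasure \<mu> UNIV \<noteq> 0 \<and> emeasure \<mu> (- \<Gamma>) = 0 \<and>
     (\<forall>A\<in>sets borel. measure \<mu> A = (\<Sum>m=1..M. p m * measure \<mu> (s m -` A)))"

text \<open>A vector index \<open>(m\<^sub>1, \<dots>, m\<^sub>\<ell>)\<close> is the list \<open>[m\<^sub>1, \<dots>, m\<^sub>\<ell>]\<close>, and the extra index \<open>0\<close>
  (with \<open>\<Gamma>\<^sub>0 = \<Gamma>\<close>) is the empty list.\<close>

definition compose_maps :: "(nat \<Rightarrow> 'a \<Rightarrow> 'a) \<Rightarrow> nat list \<Rightarrow> 'a \<Rightarrow> 'a" where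
  "compose_maps s ms = foldr (\<lambda>m g. s m \<circ> g) ms id"

definition cell :: "(nat \<Rightarrow> real^'n \<Rightarrow> real^'n) \<Rightarrow> (real^'n) set \<Rightarrow> nat list \<Rightarrow> (real^'n) set" where
  "cell s \<Gamma> ms = compose_maps s ms ` \<Gamma>"

definition L_index ::
  "nat \<Rightarrow> (nat \<Rightarrow> real^'n \<Rightarrow> real^'n) \<Rightarrow> (real^'n) set \<Rightarrow> real \<Rightarrow> nat list set" where
  "L_index M s \<Gamma> h =
     (if h < diameter \<Gamma>
      then {ms. ms \<noteq> [] \<and> set ms \<subseteq> {1..M} \<and>
                diameter (cell s \<Gamma> ms) \<le> h \<and> diameter (cell s \<Gamma> (butlast ms)) > h}
      else {[]})"

definition hull_union ::
  "nat \<Rightarrow> (nat \<Rightarrow> real^'n \<Rightarrow> real^'n) \<Rightarrow> (real^'n) set \<Rightarrow> real \<Rightarrow> (real^'n) set" where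
  "hull_union M s \<Gamma> h = (\<Union>ms\<in>L_index M s \<Gamma> h. convex hull (cell s \<Gamma> ms))"

definition barycentre :: "(real^'n) measure \<Rightarrow> (real^'n) set \<Rightarrow> real^'n" where
  "barycentre \<mu> E = (LINT x:E|\<mu>. x) /\<^sub>R measure \<mu> E"

definition barycentre_rule ::
  "nat \<Rightarrow> (nat \<Rightarrow> real^'n \<Rightarrow> real^'n) \<Rightarrow> (real^'n) set \<Rightarrow> (real^'n) measure \<Rightarrow> real \<Rightarrow>
   (real^'n \<Rightarrow> complex) \<Rightarrow> complex" where
  "barycentre_rule M s \<Gamma> \<mu> h f =
     (\<Sum>ms\<in>L_index M s \<Gamma> h.
        complex_of_real (measure \<mu> (cell s \<Gamma> ms)) * f (barycentre \<mu> (cell s \<Gamma> ms)))"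

definition partial_deriv ::
  "'n \<Rightarrow> (real^'n \<Rightarrow> 'b::real_normed_vector) \<Rightarrow> real^'n \<Rightarrow> 'b" where
  "partial_deriv i f x = vector_derivative (\<lambda>t::real. f (x + t *\<^sub>R axis i 1)) (at 0)"

definition multi_index_order :: "('n::finite \<Rightarrow> nat) \<Rightarrow> nat" where
  "multi_index_order \<alpha> = (\<Sum>i\<in>UNIV. \<alpha> i)"

text \<open>The index type \<open>'n\<close> carries no order, so the order in which the partial derivatives making
  up \<open>D\<^sup>\<alpha> f\<close> are taken is an arbitrary choice. The choice does not matter for \<open>|\<alpha>| = 1\<close>, nor for
  \<open>|\<alpha>| = 2\<close> at points where \<open>f\<close> is twice differentiable.\<close>

definition multi_deriv :: "('n::finite \<Rightarrow> nat) \<Rightarrow> (real^'n \<Rightarrow> complex) \<Rightarrow> real^'n \<Rightarrow> complex" where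
  "multi_deriv \<alpha> f = foldr partial_deriv (SOME is. \<forall>i. count_list is i = \<alpha> i) f"

text \<open>The norm of \<^typ>\<open>complex^'n\<close> is the Hermitian norm.\<close>

definition gradient :: "(real^'n \<Rightarrow> complex) \<Rightarrow> real^'n \<Rightarrow> complex^'n" where
  "gradient f x = (\<chi> i. partial_deriv i f x)"

definition hessian :: "(real^'n \<Rightarrow> complex) \<Rightarrow> real^'n \<Rightarrow> complex^'n^'n" where
  "hessian f x = (\<chi> i j. partial_deriv i (partial_deriv j f) x)"

definition matrix_norm2 :: "complex^'n^'n \<Rightarrow> real" where
  "matrix_norm2 A = onorm (\<lambda>v. A *v v)"

text \<open>Since the Frechet derivative of a differentiable \<open>f\<close> is represented by its gradient, this says
  that \<open>f\<close> and its Frechet derivative are both differentiable.\<close>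

definition twice_differentiable_on :: "(real^'n \<Rightarrow> complex) \<Rightarrow> (real^'n) set \<Rightarrow> bool" where
  "twice_differentiable_on f U \<longleftrightarrow> f differentiable_on U \<and> gradient f differentiable_on U"

text \<open>The supremum is taken in \<^typ>\<open>ennreal\<close>: it may be \<open>\<infinity>\<close>, and over a singleton \<open>E\<close> it is \<open>0\<close>.\<close>

definition lip0 :: "(real^'n) set \<Rightarrow> (real^'n \<Rightarrow> 'b::real_normed_vector) \<Rightarrow> ennreal" where
  "lip0 E f = (SUP (x, y)\<in>{(x, y). x \<in> E \<and> y \<in> E \<and> x \<noteq> y}.
                 ennreal (norm (f x - f y) / norm (x - y)))"

definition lip1 :: "(real^'n) set \<Rightarrow> (real^'n \<Rightarrow> complex) \<Rightarrow> ennreal" where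
  "lip1 E f = lip0 E (gradient f)"

end

theory Submission
  imports Defs "HOL-Library.Sublist"
begin

text \<open>
  The error is a sum over the cells \<open>\<Gamma>\<^sub>w\<close>, \<open>w \<in> L\<^sub>h(\<Gamma>)\<close>, of
  \<open>\<integral>\<^bsub>\<Gamma>\<^sub>w\<^esub> (f(x) - f(x\<^sub>w)) d\<mu>(x)\<close>. For any linear \<open>D\<close> the integrand may be replaced by the
  remainder \<open>f(x) - f(x\<^sub>w) - D(x - x\<^sub>w)\<close>, because \<open>x - x\<^sub>w\<close> has mean zero over \<open>\<Gamma>\<^sub>w\<close>: that is
  the point of choosing the barycentre. Cells have diameter at most \<open>h\<close> and \<open>x\<^sub>w\<close> lies in the
  convex hull of its cell, so \<open>D = 0\<close> gives the first-order bound, and the derivative of \<open>f\<close> at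
  \<open>x\<^sub>w\<close> gives the second-order one, the Taylor remainder being at most
  \<open>1/2 * \<L>\<^sub>1[f] * h\<^sup>2\<close>. The factor \<open>1/2\<close> is kept, so this one estimate yields both the bound by
  \<open>\<L>\<^sub>1\<close> and the bound by the Hessian. The estimates by gradient and Hessian follow since \<open>\<L>\<^sub>0\<close>
  of a function on a convex set is at most the supremum of the norm of its derivative.

  Everything rests on the decomposition \<open>\<integral>\<^bsub>\<Gamma>\<^esub> = \<Sum>\<^sub>w \<integral>\<^bsub>\<Gamma>\<^sub>w\<^esub>\<close>, that is, on the fact that two cells
  with incomparable words meet in a set of measure zero (\<open>measure_cell_overlap\<close>). This is where
  the open set condition enters. For Hausdorff measure on \<open>\<Gamma>\<close> it would follow by comparing the
  measures of the cells; for general weights \<open>p\<^sub>m\<close> the argument has two parts.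

  Geometry (\<open>detached_word\<close>, after Schief's proof that the open set condition implies the strong
  one): by the open set condition, the number of cells of size comparable to that of \<open>\<Gamma>\<^sub>k\<close> that
  meet \<open>\<Gamma>\<^sub>k\<close> is bounded in \<open>k\<close>. Take \<open>k\<close> for which it is maximal. The neighbours of \<open>\<Gamma>\<^sub>k\<close>
  are mapped by \<open>s\<^sub>i\<close> to neighbours of \<open>\<Gamma>\<^sub>i\<^sub>k\<close>, and by maximality there are no others. Hence
  \<open>\<Gamma>\<^sub>i\<^sub>k\<close> is disjoint from every cell \<open>\<Gamma>\<^sub>j\<close> whose word is incomparable to \<open>i\<close>.

  Measure: let \<open>i\<close> and \<open>j\<close> be incomparable. A point chosen by \<open>\<mu>\<close> inside \<open>\<Gamma>\<^sub>i\<close> almost surely has the block \<open>k\<close> somewhere in its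
  address after \<open>i\<close>, and is then outside \<open>\<Gamma>\<^sub>j\<close>. In terms of finite words: for a Borel
  set \<open>A\<close> the function \<open>i \<mapsto> \<mu>(s\<^sub>i\<inverse>(A))\<close> is harmonic on the tree of words, and on a set of words
  closed under extension, a bounded nonnegative harmonic function that vanishes at \<open>ik\<close> for each
  \<open>i\<close> in the set is zero, by a contraction argument (\<open>harmonic_on_words_eq_0\<close>).
\<close>

section \<open>Words and cells of a self-similar set\<close>

lemma compose_maps_Nil [simp]: "compose_maps s [] = id"
  by (simp add: compose_maps_def)

lemma compose_maps_Cons [simp]: "compose_maps s (m # w) x = s m (compose_maps s w x)"
  by (simp add: compose_maps_def)

lemma compose_maps_append [simp]:
  "compose_maps s (v @ w) x = compose_maps s v (compose_maps s w x)"
  by (induction v) simp_all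

text \<open>The similarities enter through their intrinsic properties, scaling of distances by \<open>r m\<close> and
  surjectivity. The letters form an abstract finite set \<open>J\<close>, which keeps the simplifier from
  rewriting membership in \<open>{1..M}\<close>.\<close>

locale self_similar_set =
  fixes J :: "nat set" and s :: "nat \<Rightarrow> real^'n \<Rightarrow> real^'n" and r :: "nat \<Rightarrow> real"
    and \<Gamma> :: "(real^'n) set"
  assumes finite_J: "finite J" and J_nonempty: "J \<noteq> {}"
    and r_pos: "m \<in> J \<Longrightarrow> 0 < r m"
    and r_less_1: "m \<in> J \<Longrightarrow> r m < 1"
    and dist_map: "m \<in> J \<Longrightarrow> dist (s m x) (s m y) = r m * dist x y"
    and surj_map: "m \<in> J \<Longrightarrow> surj (s m)"
    and compact_attractor: "compact \<Gamma>"
    and attractor_nonempty: "\<Gamma> \<noteq> {}"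
    and attractor_eq: "\<Gamma> = (\<Union>m\<in>J. s m ` \<Gamma>)"
begin

abbreviation words :: "nat list set" where "words \<equiv> lists J"

definition ratio :: "nat list \<Rightarrow> real" where "ratio w = prod_list (map r w)"

text \<open>The words at which the contraction ratio first drops to \<open>t\<close> or below. Since
  \<open>diam \<Gamma>\<^sub>w = ratio w * diam \<Gamma>\<close>, this is \<open>L\<^sub>h(\<Gamma>)\<close> for \<open>t = h / diam \<Gamma> < 1\<close>, but the definition also
  makes sense when \<open>\<Gamma>\<close> is a single point.\<close>

definition cut :: "real \<Rightarrow> nat list set" where
  "cut t = {w \<in> words. w \<noteq> [] \<and> ratio w \<le> t \<and> t < ratio (butlast w)}"

lemma ratio_simps [simp]:
  "ratio [] = 1" "ratio (m # w) = r m * ratio w" "ratio (v @ w) = ratio v * ratio w"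
  by (simp_all add: ratio_def)

lemma ratio_pos: "w \<in> words \<Longrightarrow> 0 < ratio w"
  by (induction w) (auto simp: r_pos)

lemma ratio_le_1: "w \<in> words \<Longrightarrow> ratio w \<le> 1"
proof (induction w)
  case (Cons m w)
  then show ?case
    using mult_mono[of "r m" 1 "ratio w" 1] r_less_1[of m] ratio_pos[of w] by auto
qed simp

lemma ratio_prefix_antimono:
  assumes "prefix v w" "w \<in> words" shows "ratio w \<le> ratio v"
proof -
  obtain u where u: "w = v @ u" using assms(1) by (auto simp: prefix_def)
  with assms(2) have "v \<in> words" "u \<in> words" by auto
  then show ?thesis
    using u mult_left_le[of "ratio u" "ratio v"] ratio_le_1[of u] ratio_pos[of v] by simp
qed

lemma small_ratio:
  assumes "0 < t" shows "\<exists>n. \<forall>w\<in>words. n \<le> length w \<longrightarrow> ratio w \<le> t"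
proof -
  define q where "q = Max (r ` J)"
  have q: "r m \<le> q" if "m \<in> J" for m
    unfolding q_def using that finite_J by (intro Max_ge) auto
  have "q \<in> r ` J" unfolding q_def using finite_J J_nonempty by (intro Max_in) auto
  then have q01: "0 < q" "q < 1" using r_pos r_less_1 by auto
  have le: "ratio w \<le> q ^ length w" if "w \<in> words" for w
    using that
  proof (induction w)
    case (Cons m w)
    then show ?case using q[of m] r_pos[of m] ratio_pos[of w] q01
      by (auto intro!: mult_mono)
  qed simp
  obtain n where n: "q ^ n < t" using real_arch_pow_inv[OF assms q01(2)] by blast
  have "ratio w \<le> t" if "w \<in> words" "n \<le> length w" for w
  proof -
    have "q ^ length w \<le> q ^ n" using q01 that by (intro power_decreasing) auto
    then show ?thesis using le[OF that(1)] n by linarith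
  qed
  then show ?thesis by blast
qed

lemma dist_compose: "w \<in> words \<Longrightarrow> dist (compose_maps s w x) (compose_maps s w y) = ratio w * dist x y"
  by (induction w) (auto simp: dist_map)

lemma inj_compose: "w \<in> words \<Longrightarrow> inj (compose_maps s w)"
  by (intro injI) (metis dist_compose dist_eq_0_iff mult_eq_0_iff ratio_pos less_irrefl)

lemma surj_compose: "w \<in> words \<Longrightarrow> surj (compose_maps s w)"
proof (induction w)
  case (Cons m w)
  have "compose_maps s (m # w) = s m \<circ> compose_maps s w" by (simp add: fun_eq_iff)
  with Cons surj_map[of m] show ?case by (metis comp_surj Cons_in_lists_iff)
qed simp

lemma continuous_compose: "w \<in> words \<Longrightarrow> continuous_on A (compose_maps s w)"
proof -
  assume w: "w \<in> words"
  have "(ratio w)-lipschitz_on A (compose_maps s w)"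
    using dist_compose[OF w] ratio_pos[OF w] by (intro lipschitz_onI) auto
  then show ?thesis by (rule lipschitz_on_continuous_on)
qed

lemma compact_cell: "w \<in> words \<Longrightarrow> compact (cell s \<Gamma> w)"
  unfolding cell_def by (intro compact_continuous_image continuous_compose compact_attractor)

lemma compose_attractor: "w \<in> words \<Longrightarrow> x \<in> \<Gamma> \<Longrightarrow> compose_maps s w x \<in> \<Gamma>"
proof (induction w)
  case (Cons m w)
  then show ?case by (subst attractor_eq) auto
qed simp

lemma cell_Nil [simp]: "cell s \<Gamma> [] = \<Gamma>"
  by (simp add: cell_def)

lemma cell_append_subset: "w \<in> words \<Longrightarrow> cell s \<Gamma> (v @ w) \<subseteq> cell s \<Gamma> v"
  by (auto simp: cell_def intro!: imageI compose_attractor)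

lemma cell_prefix_subset: "prefix v w \<Longrightarrow> w \<in> words \<Longrightarrow> cell s \<Gamma> w \<subseteq> cell s \<Gamma> v"
  using cell_append_subset by (metis append_in_lists_conv prefixE)

lemma cell_subset: "w \<in> words \<Longrightarrow> cell s \<Gamma> w \<subseteq> \<Gamma>"
  using cell_append_subset[of w "[]"] by simp

lemma diameter_cell:
  assumes w: "w \<in> words" shows "diameter (cell s \<Gamma> w) = ratio w * diameter \<Gamma>"
proof (rule antisym)
  have bd: "bounded \<Gamma>" "bounded (cell s \<Gamma> w)"
    using compact_attractor compact_cell[OF w] by (auto intro: compact_imp_bounded)
  show "diameter (cell s \<Gamma> w) \<le> ratio w * diameter \<Gamma>"
  proof (rule diameter_le)
    show "cell s \<Gamma> w \<noteq> {} \<or> 0 \<le> ratio w * diameter \<Gamma>"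
      using attractor_nonempty by (auto simp: cell_def)
    show "norm (x - y) \<le> ratio w * diameter \<Gamma>" if "x \<in> cell s \<Gamma> w" "y \<in> cell s \<Gamma> w" for x y
      using that diameter_bounded_bound[OF bd(1)] dist_compose[OF w] ratio_pos[OF w]
      by (auto simp: cell_def dist_norm[symmetric])
  qed
  obtain x y where xy: "x \<in> \<Gamma>" "y \<in> \<Gamma>" "dist x y = diameter \<Gamma>"
    using diameter_compact_attained[OF compact_attractor attractor_nonempty] by auto
  then have "dist (compose_maps s w x) (compose_maps s w y) \<le> diameter (cell s \<Gamma> w)"
    by (intro diameter_bounded_bound[OF bd(2)]) (auto simp: cell_def)
  then show "ratio w * diameter \<Gamma> \<le> diameter (cell s \<Gamma> w)"
    using dist_compose[OF w] xy by simp
qed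

lemma deeper_cell:
  assumes "x \<in> cell s \<Gamma> v" "v \<in> words"
  shows "\<exists>u\<in>words. length u = n \<and> x \<in> cell s \<Gamma> (v @ u)"
proof (induction n)
  case 0
  then show ?case using assms by auto
next
  case (Suc n)
  then obtain u y where u: "u \<in> words" "length u = n" "x = compose_maps s (v @ u) y" "y \<in> \<Gamma>"
    by (auto simp: cell_def)
  then obtain m z where "m \<in> J" "z \<in> \<Gamma>" "y = s m z"
    using attractor_eq by blast
  then show ?case using u by (intro bexI[of _ "u @ [m]"]) (auto simp: cell_def)
qed

text \<open>Every point of a cell has an address extending the word of that cell, and one may follow it
  until the cells are as small as desired.\<close>

lemma deep_cell:
  assumes "x \<in> cell s \<Gamma> v" "v \<in> words" "0 < t"
  shows "\<exists>u\<in>words. ratio (v @ u) \<le> t \<and> x \<in> cell s \<Gamma> (v @ u)"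
proof -
  obtain n where n: "\<forall>w\<in>words. n \<le> length w \<longrightarrow> ratio w \<le> t"
    using small_ratio[OF assms(3)] by blast
  obtain u where "u \<in> words" "length u = n" "x \<in> cell s \<Gamma> (v @ u)"
    using deeper_cell[OF assms(1,2)] by blast
  moreover have "ratio (v @ u) \<le> t"
    using n \<open>u \<in> words\<close> \<open>length u = n\<close> assms(2) by (metis append_in_lists_conv le_add2 length_append)
  ultimately show ?thesis by blast
qed

lemma prefix_in_cut:
  assumes "w \<in> words" "ratio w \<le> t" "t < 1"
  shows "\<exists>v\<in>cut t. prefix v w"
  using assms
proof (induction w rule: rev_induct)
  case (snoc m w)
  show ?case
  proof (cases "ratio w \<le> t")
    case True
    with snoc obtain v where "v \<in> cut t" "prefix v w" by auto
    then show ?thesis by (meson prefix_order.trans prefixI)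
  next
    case False
    with snoc have "w @ [m] \<in> cut t" by (auto simp: cut_def)
    then show ?thesis by auto
  qed
qed simp

text \<open>If \<open>v\<close> were a proper prefix of \<open>w\<close>, it would be a prefix of \<open>butlast w\<close>, whose ratio is still
  above \<open>t\<close>, while that of \<open>v\<close> is not.\<close>

lemma cut_parallel:
  assumes "v \<in> cut t" "w \<in> cut t" "v \<noteq> w" shows "v \<parallel> w"
proof -
  have *: False if "v \<in> cut t" "w \<in> cut t" "strict_prefix v w" for v w
  proof -
    have "prefix v (butlast w)"
      using that(3) by (metis append_butlast_last_id prefix_snoc strict_prefix_def strict_prefix_simps(1))
    then have "ratio (butlast w) \<le> ratio v"
      using that(2) by (intro ratio_prefix_antimono) (auto simp: cut_def dest: in_set_butlastD)
    with that show False by (auto simp: cut_def)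
  qed
  then show ?thesis using assms *[of v w] *[of w v] by (auto simp: strict_prefix_def)
qed

lemma finite_cut: assumes "0 < t" shows "finite (cut t)"
proof -
  obtain n where n: "\<forall>w\<in>words. n \<le> length w \<longrightarrow> ratio w \<le> t"
    using small_ratio[OF assms] by blast
  have "length w \<le> n" if "w \<in> cut t" for w
  proof (rule ccontr)
    assume "\<not> length w \<le> n"
    moreover have "butlast w \<in> words" using that by (auto simp: cut_def dest: in_set_butlastD)
    ultimately have "ratio (butlast w) \<le> t" using n by simp
    with that show False by (simp add: cut_def)
  qed
  then have "cut t \<subseteq> {w. set w \<subseteq> J \<and> length w \<le> n}" by (auto simp: cut_def)
  then show ?thesis using finite_lists_length_le[OF finite_J, of n] by (auto intro: finite_subset)
qed

lemma attractor_eq_Union_cut: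
  assumes "0 < t" "t < 1" shows "\<Gamma> = (\<Union>w\<in>cut t. cell s \<Gamma> w)"
proof
  show "(\<Union>w\<in>cut t. cell s \<Gamma> w) \<subseteq> \<Gamma>" using cell_subset by (auto simp: cut_def)
  show "\<Gamma> \<subseteq> (\<Union>w\<in>cut t. cell s \<Gamma> w)"
  proof
    fix x assume "x \<in> \<Gamma>"
    then obtain u where u: "u \<in> words" "ratio u \<le> t" "x \<in> cell s \<Gamma> u"
      using deep_cell[of x "[]" t] assms by auto
    then obtain v where "v \<in> cut t" "prefix v u" using prefix_in_cut assms by blast
    then show "x \<in> (\<Union>w\<in>cut t. cell s \<Gamma> w)" using cell_prefix_subset u by blast
  qed
qed

text \<open>At the first letter where the words differ, the images are separated by the open set condition;
  the common prefix acts injectively.\<close>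

lemma parallel_images_disjoint:
  assumes U: "\<And>m. m \<in> J \<Longrightarrow> s m ` U \<subseteq> U"
    and dj: "\<And>m m'. m \<in> J \<Longrightarrow> m' \<in> J \<Longrightarrow> m \<noteq> m' \<Longrightarrow> s m ` U \<inter> s m' ` U = {}"
    and vw: "v \<in> words" "w \<in> words" "v \<parallel> w"
  shows "compose_maps s v ` U \<inter> compose_maps s w ` U = {}"
proof -
  obtain a b bs c cs where d: "b \<noteq> c" "v = a @ b # bs" "w = a @ c # cs"
    using parallel_decomp[OF vw(3)] by blast
  have sub: "compose_maps s u x \<in> U" if "u \<in> words" "x \<in> U" for u x
    using that by (induction u) (use U in auto)
  have "False" if "x \<in> U" "y \<in> U" "compose_maps s v x = compose_maps s w y" for x y
  proof -
    have "a \<in> words" using vw d by auto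
    from that(3) d have "s b (compose_maps s bs x) = s c (compose_maps s cs y)"
      using inj_compose[OF \<open>a \<in> words\<close>] by (auto dest: injD)
    then show False using dj[of b c] sub[of bs x] sub[of cs y] vw d that by auto
  qed
  then show ?thesis by auto
qed

end

section \<open>A word whose cell avoids all incomparable cells\<close>

lemma separated_card_bounded:
  fixes B :: "'a::euclidean_space set"
  assumes "bounded B" "0 < d"
  shows "\<exists>N. \<forall>Y\<subseteq>B. (\<forall>x\<in>Y. \<forall>y\<in>Y. x \<noteq> y \<longrightarrow> d \<le> dist x y) \<longrightarrow> finite Y \<and> card Y \<le> N"
proof -
  have "compact (closure B)" using assms by simp
  then obtain K where K: "finite K" "closure B \<subseteq> (\<Union>x\<in>K. ball x (d/2))"
    using compact_eq_totally_bounded[of "closure B"] assms(2) by (meson half_gt_zero)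
  have "finite Y \<and> card Y \<le> card K"
    if Y: "Y \<subseteq> B" "\<forall>x\<in>Y. \<forall>y\<in>Y. x \<noteq> y \<longrightarrow> d \<le> dist x y" for Y
  proof -
    have "\<exists>x\<in>K. y \<in> ball x (d/2)" if "y \<in> Y" for y
      using that Y K closure_subset by blast
    then obtain g where g: "\<And>y. y \<in> Y \<Longrightarrow> g y \<in> K \<and> y \<in> ball (g y) (d/2)" by metis
    have "inj_on g Y"
    proof (rule inj_onI, rule ccontr)
      fix x y assume xy: "x \<in> Y" "y \<in> Y" "g x = g y" "x \<noteq> y"
      then have "dist (g x) x < d/2" "dist (g x) y < d/2" using g[of x] g[of y] by auto
      then have "dist x y < d" by (rule dist_triangle_half_r)
      with Y xy show False by force
    qed
    then show ?thesis using K(1) g by (meson card_inj_on_le image_subsetI inj_on_finite)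
  qed
  then show ?thesis by blast
qed

context self_similar_set
begin

text \<open>The cells of about the size of \<open>\<Gamma>\<^sub>k\<close> that touch it, \<open>\<Gamma>\<^sub>k\<close> itself included.\<close>

definition neighbours :: "nat list \<Rightarrow> nat list set" where
  "neighbours k = {j \<in> cut (ratio k). cell s \<Gamma> j \<inter> cell s \<Gamma> k \<noteq> {}}"

text \<open>Rescale by \<open>1 / ratio k\<close>. The images of a ball in the feasible open set under the maps of the
  neighbours are disjoint, and after rescaling their radii are bounded below and their centres lie
  in a fixed ball; a bounded set contains boundedly many points with a given separation.\<close>

lemma card_neighbours_bounded:
  assumes U: "open U" "U \<noteq> {}" "\<And>m. m \<in> J \<Longrightarrow> s m ` U \<subseteq> U"
    and dj: "\<And>m m'. m \<in> J \<Longrightarrow> m' \<in> J \<Longrightarrow> m \<noteq> m' \<Longrightarrow> s m ` U \<inter> s m' ` U = {}"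
  shows "\<exists>N. \<forall>k\<in>words. card (neighbours k) \<le> N"
proof -
  obtain c a where ca: "0 < a" "ball c a \<subseteq> U"
    using U(1,2) by (metis all_not_in_conv open_contains_ball)
  obtain D where D: "\<And>x. x \<in> \<Gamma> \<Longrightarrow> dist c x \<le> D"
    using compact_imp_bounded[OF compact_attractor] bounded_any_center[of \<Gamma> c] by auto
  obtain x0 where x0: "x0 \<in> \<Gamma>" using attractor_nonempty by auto
  define q where "q = Min (r ` J)"
  have q: "q \<le> r m" if "m \<in> J" for m
    unfolding q_def using that finite_J by (intro Min_le) auto
  have "q \<in> r ` J" unfolding q_def using finite_J J_nonempty by (intro Min_in) auto
  then have q0: "0 < q" using r_pos by auto
  obtain N where N: "\<forall>Y\<subseteq>cball (0::real^'n) (3*D).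
      (\<forall>x\<in>Y. \<forall>y\<in>Y. x \<noteq> y \<longrightarrow> q * a \<le> dist x y) \<longrightarrow> finite Y \<and> card Y \<le> N"
    using separated_card_bounded[OF bounded_cball mult_pos_pos[OF q0 ca(1)]] ..
  have "card (neighbours k) \<le> N" if k: "k \<in> words" for k
  proof -
    define \<phi> where "\<phi> j = (compose_maps s j c - compose_maps s k x0) /\<^sub>R ratio k" for j
    have pos: "0 < ratio k" using ratio_pos k .
    have \<phi>_dist: "dist (\<phi> i) (\<phi> j) = dist (compose_maps s i c) (compose_maps s j c) / ratio k" for i j
    proof -
      have "\<phi> i - \<phi> j = (compose_maps s i c - compose_maps s j c) /\<^sub>R ratio k"
        by (simp add: \<phi>_def scaleR_diff_right)
      then show ?thesis using pos unfolding dist_norm by (simp add: divide_inverse mult.commute)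
    qed
    have sep: "q * a \<le> dist (\<phi> i) (\<phi> j)"
      if ij: "i \<in> neighbours k" "j \<in> neighbours k" "i \<noteq> j" for i j
    proof -
      have w: "i \<in> words" "j \<in> words" "i \<noteq> []" and i: "ratio k < ratio (butlast i)"
        and par: "i \<parallel> j"
        using ij cut_parallel by (auto simp: neighbours_def cut_def)
      have "ratio i = ratio (butlast i) * r (last i)"
        using w by (metis append_butlast_last_id mult.right_neutral ratio_simps)
      moreover have "last i \<in> J" using w by (metis in_lists_conv_set last_in_set)
      ultimately have big: "q * ratio k \<le> ratio i"
        using mult_mono[of "ratio k" "ratio (butlast i)" q "r (last i)"] q[of "last i"] i pos q0
        by (simp add: mult.commute)
      obtain y where y: "compose_maps s j c = compose_maps s i y"
        using surj_compose[OF w(1)] by (metis surjD)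
      \<comment> \<open>If the centres were closer, the centre of the image for \<open>j\<close> would lie in the image for \<open>i\<close>.\<close>
      have "a \<le> dist c y"
      proof (rule ccontr)
        assume "\<not> a \<le> dist c y"
        then have "y \<in> U" "c \<in> U" using ca by auto
        then show False
          using parallel_images_disjoint[of U, OF U(3) dj w(1,2) par] y by blast
      qed
      then have "q * ratio k * a \<le> ratio i * dist c y"
        using big ca ratio_pos[OF w(1)] by (intro mult_mono) auto
      then show ?thesis
        unfolding \<phi>_dist y using dist_compose[OF w(1)] pos by (simp add: field_simps)
    qed
    \<comment> \<open>Through a common point of the two cells: \<open>ratio j * D\<close> on the side of \<open>j\<close>, and on the side of
      \<open>k\<close> two points of \<open>\<Gamma>\<close>, at distance at most \<open>2 * D\<close>.\<close>
    have "\<phi> ` neighbours k \<subseteq> cball 0 (3*D)"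
    proof clarify
      fix j assume "j \<in> neighbours k"
      then obtain x y where j: "j \<in> words" "ratio j \<le> ratio k" "x \<in> \<Gamma>" "y \<in> \<Gamma>"
        "compose_maps s j x = compose_maps s k y"
        by (auto simp: neighbours_def cut_def cell_def)
      have "dist (compose_maps s j c) (compose_maps s k x0)
          \<le> dist (compose_maps s j c) (compose_maps s j x) + dist (compose_maps s k y) (compose_maps s k x0)"
        using dist_triangle[of "compose_maps s j c" "compose_maps s k x0" "compose_maps s j x"] j by simp
      also have "\<dots> = ratio j * dist c x + ratio k * dist y x0"
        by (simp only: dist_compose[OF j(1)] dist_compose[OF k])
      also have "\<dots> \<le> ratio k * D + ratio k * (D + D)"
      proof (intro add_mono mult_mono mult_left_mono)
        show "dist y x0 \<le> D + D"
          using dist_triangle3[of y x0 c] D[OF j(4)] D[OF x0] by linarith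
      qed (use j D pos in auto)
      finally have "norm (compose_maps s j c - compose_maps s k x0) \<le> 3 * D * ratio k"
        by (simp add: dist_norm algebra_simps)
      moreover have "norm (\<phi> j) = norm (compose_maps s j c - compose_maps s k x0) / ratio k"
        using pos by (simp add: \<phi>_def divide_inverse mult.commute)
      ultimately show "\<phi> j \<in> cball 0 (3*D)" using pos by (simp add: pos_divide_le_eq)
    qed
    then have "card (\<phi> ` neighbours k) \<le> N" using N[rule_format, of "\<phi> ` neighbours k"] sep by blast
    moreover have "inj_on \<phi> (neighbours k)"
    proof (rule inj_onI, rule ccontr)
      fix i j assume "i \<in> neighbours k" "j \<in> neighbours k" "\<phi> i = \<phi> j" "i \<noteq> j"
      with sep[of i j] show False using mult_pos_pos[OF q0 ca(1)] by simp
    qed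
    ultimately show ?thesis by (simp add: card_image)
  qed
  then show ?thesis by blast
qed

text \<open>Choose a nonempty \<open>k\<close> with the most neighbours; being nonempty makes \<open>ratio (i @ k) < 1\<close>, so that
  every long word has a prefix in the corresponding cut. Prepending \<open>i\<close> maps neighbours of \<open>k\<close> to
  neighbours of \<open>ik\<close>, so by maximality every neighbour of \<open>ik\<close> begins with \<open>i\<close>. A point common
  to \<open>\<Gamma>\<^sub>i\<^sub>k\<close> and \<open>\<Gamma>\<^sub>j\<close> would produce a neighbour of \<open>ik\<close> comparable to \<open>j\<close>, which forces \<open>i\<close>
  and \<open>j\<close> to be comparable.\<close>

lemma detached_word:
  assumes U: "open U" "U \<noteq> {}" "\<And>m. m \<in> J \<Longrightarrow> s m ` U \<subseteq> U"
    and dj: "\<And>m m'. m \<in> J \<Longrightarrow> m' \<in> J \<Longrightarrow> m \<noteq> m' \<Longrightarrow> s m ` U \<inter> s m' ` U = {}"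
  obtains k where "k \<in> words"
    "\<And>i j. i \<in> words \<Longrightarrow> j \<in> words \<Longrightarrow> i \<parallel> j \<Longrightarrow> cell s \<Gamma> (i @ k) \<inter> cell s \<Gamma> j = {}"
proof -
  define P where "P k \<longleftrightarrow> k \<in> words \<and> k \<noteq> []" for k
  obtain N where N: "\<forall>k\<in>words. card (neighbours k) \<le> N"
    using card_neighbours_bounded[OF assms] by metis
  obtain m0 where "P [m0]" using J_nonempty by (auto simp: P_def)
  then obtain k where k: "P k" "\<And>k'. P k' \<Longrightarrow> card (neighbours k') \<le> card (neighbours k)"
    using ex_has_greatest_nat[of P "[m0]" "\<lambda>k. card (neighbours k)" "Suc N"] N
    by (force simp: P_def less_Suc_eq_le)
  have kw: "k \<in> words" "k \<noteq> []" using k(1) by (auto simp: P_def)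
  have fin: "finite (neighbours w)" if "w \<in> words" for w
    using finite_cut[OF ratio_pos[OF that]] by (auto simp: neighbours_def)
  have nb: "neighbours (i @ k) = (@) i ` neighbours k" if i: "i \<in> words" for i
  proof (rule sym, rule card_seteq)
    show "finite (neighbours (i @ k))" using fin i kw by simp
    show "(@) i ` neighbours k \<subseteq> neighbours (i @ k)"
    proof clarify
      fix j assume "j \<in> neighbours k"
      then have j: "j \<in> words" "j \<noteq> []" "ratio j \<le> ratio k" "ratio k < ratio (butlast j)"
        "cell s \<Gamma> j \<inter> cell s \<Gamma> k \<noteq> {}"
        by (auto simp: neighbours_def cut_def)
      have "i @ j \<in> cut (ratio (i @ k))"
        using i j ratio_pos[OF i] by (auto simp: cut_def butlast_append)
      moreover have "cell s \<Gamma> (i @ j) \<inter> cell s \<Gamma> (i @ k) \<noteq> {}"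
      proof -
        obtain x y where "x \<in> \<Gamma>" "y \<in> \<Gamma>" "compose_maps s j x = compose_maps s k y"
          using j(5) by (auto simp: cell_def)
        then have "compose_maps s (i @ j) x = compose_maps s (i @ k) y" by simp
        with \<open>x \<in> \<Gamma>\<close> \<open>y \<in> \<Gamma>\<close> show ?thesis unfolding cell_def by blast
      qed
      ultimately show "i @ j \<in> neighbours (i @ k)" by (simp add: neighbours_def)
    qed
    have "card ((@) i ` neighbours k) = card (neighbours k)" by (intro card_image) (auto simp: inj_on_def)
    then show "card (neighbours (i @ k)) \<le> card ((@) i ` neighbours k)"
      using k(2)[of "i @ k"] i kw by (simp add: P_def)
  qed
  have "cell s \<Gamma> (i @ k) \<inter> cell s \<Gamma> j = {}" if ij: "i \<in> words" "j \<in> words" "i \<parallel> j" for i j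
  proof (rule ccontr)
    assume "cell s \<Gamma> (i @ k) \<inter> cell s \<Gamma> j \<noteq> {}"
    then obtain x where x: "x \<in> cell s \<Gamma> (i @ k)" "x \<in> cell s \<Gamma> j" by auto
    have ik: "i @ k \<in> words" using ij kw by simp
    obtain u where u: "u \<in> words" "ratio (j @ u) \<le> ratio (i @ k)" "x \<in> cell s \<Gamma> (j @ u)"
      using deep_cell[OF x(2) ij(2) ratio_pos[OF ik]] by blast
    have "ratio k < 1"
    proof -
      obtain m k' where "k = m # k'" using kw by (cases k) auto
      with kw have "m \<in> J" "k' \<in> words" by auto
      then have "r m * ratio k' \<le> r m" using r_pos ratio_le_1 by (intro mult_left_le) (auto intro: less_imp_le)
      then show ?thesis using r_less_1[OF \<open>m \<in> J\<close>] \<open>k = m # k'\<close> by simp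
    qed
    moreover have "ratio i * ratio k \<le> 1 * ratio k"
      using ratio_le_1[OF ij(1)] ratio_pos[OF kw(1)] by (intro mult_right_mono) auto
    ultimately have "ratio (i @ k) < 1" by simp
    then obtain v where v: "v \<in> cut (ratio (i @ k))" "prefix v (j @ u)"
      using prefix_in_cut[OF _ u(2)] u(1) ij(2) by (metis append_in_lists_conv)
    then have "x \<in> cell s \<Gamma> v" using cell_prefix_subset[OF v(2)] u ij by auto
    \<comment> \<open>\<open>v\<close> may be shorter or longer than \<open>j\<close>; both are prefixes of \<open>j @ u\<close>.\<close>
    then have "v \<in> neighbours (i @ k)" using v x by (auto simp: neighbours_def)
    then have "prefix i v" using nb[OF ij(1)] by auto
    then have "prefix i (j @ u)" using v(2) by (rule prefix_order.trans)
    then show False using ij(3) by (metis parallelE prefixI prefix_same_cases)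
  qed
  with kw that show ?thesis by blast
qed

end

section \<open>Cells with incomparable words overlap in a null set\<close>

text \<open>Let \<open>\<sigma>\<close> be the supremum of \<open>g\<close> over \<open>X\<close>. Expanding \<open>g i\<close> along the letters of \<open>k\<close>, the word
  \<open>ik\<close> contributes nothing and all other words, of total weight \<open>1 - p\<^sub>k\<close>, at most \<open>\<sigma>\<close>. So
  \<open>\<sigma> \<le> (1 - p\<^sub>k) \<sigma>\<close>, which forces \<open>\<sigma> \<le> 0\<close>.\<close>

lemma harmonic_on_words_eq_0:
  fixes g :: "'b list \<Rightarrow> real" and p :: "'b \<Rightarrow> real"
  assumes J: "finite J" "\<And>m. m \<in> J \<Longrightarrow> 0 < p m" "sum p J = 1"
    and X: "\<And>i m. i \<in> X \<Longrightarrow> m \<in> J \<Longrightarrow> i @ [m] \<in> X"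
    and harmonic: "\<And>i. i \<in> X \<Longrightarrow> g i = (\<Sum>m\<in>J. p m * g (i @ [m]))"
    and g: "\<And>i. i \<in> X \<Longrightarrow> 0 \<le> g i" "\<And>i. i \<in> X \<Longrightarrow> g i \<le> B"
    and k: "k \<in> lists J" "\<And>i. i \<in> X \<Longrightarrow> g (i @ k) = 0"
    and i: "i \<in> X"
  shows "g i = 0"
proof -
  define \<sigma> where "\<sigma> = Sup (g ` X)"
  define q where "q u = prod_list (map p u)" for u
  have bdd: "bdd_above (g ` X)" using g(2) by (auto intro!: bdd_aboveI[of _ B])
  have le: "g j \<le> \<sigma>" if "j \<in> X" for j
    unfolding \<sigma>_def using that bdd by (intro cSup_upper) auto
  have contract: "g j \<le> (1 - q u) * \<sigma>" if "u \<in> lists J" "j \<in> X" "g (j @ u) = 0" for u j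
    using that
  proof (induction u arbitrary: j)
    case (Cons m u)
    have m: "m \<in> J" using Cons by auto
    have "g (j @ [m]) \<le> (1 - q u) * \<sigma>"
      using Cons.prems X m by (intro Cons.IH) auto
    then have "p m * g (j @ [m]) \<le> p m * ((1 - q u) * \<sigma>)"
      using J(2)[OF m] by (intro mult_left_mono) auto
    moreover have "(\<Sum>m'\<in>J - {m}. p m' * g (j @ [m'])) \<le> (\<Sum>m'\<in>J - {m}. p m' * \<sigma>)"
      using Cons.prems J(2) X le by (intro sum_mono mult_left_mono) (auto intro: less_imp_le)
    moreover have "(\<Sum>m'\<in>J - {m}. p m' * \<sigma>) = (1 - p m) * \<sigma>"
      using J m by (simp add: sum_distrib_right[symmetric] sum_diff1)
    moreover have "g j = p m * g (j @ [m]) + (\<Sum>m'\<in>J - {m}. p m' * g (j @ [m']))"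
      using harmonic[OF Cons.prems(1)] J(1) m by (simp add: sum.remove)
    ultimately have "g j \<le> p m * ((1 - q u) * \<sigma>) + (1 - p m) * \<sigma>" by linarith
    then show ?case by (simp add: q_def algebra_simps)
  qed (simp add: q_def)
  have qk: "0 < q k" using k(1) J(2) by (induction k) (auto simp: q_def)
  have "\<sigma> \<le> (1 - q k) * \<sigma>"
    unfolding \<sigma>_def using i contract[OF k(1) _ k(2), unfolded \<sigma>_def] by (intro cSup_least) auto
  then have "q k * \<sigma> \<le> 0" by (simp add: algebra_simps)
  then have "\<sigma> \<le> 0" using qk by (simp add: mult_le_0_iff)
  then show ?thesis using le[OF i] g(1)[OF i] by linarith
qed

locale self_similar_measure = self_similar_set J s r \<Gamma>
  for J :: "nat set" and s :: "nat \<Rightarrow> real^'n \<Rightarrow> real^'n" and r \<Gamma> +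
  fixes p :: "nat \<Rightarrow> real" and \<mu> :: "(real^'n) measure"
  assumes sets_\<mu> [measurable_cong]: "sets \<mu> = sets borel"
    and finite_\<mu>: "finite_measure \<mu>"
    and \<mu>_nonzero: "emeasure \<mu> UNIV \<noteq> 0"
    and supported: "emeasure \<mu> (- \<Gamma>) = 0"
    and invariant: "A \<in> sets borel \<Longrightarrow> measure \<mu> A = (\<Sum>m\<in>J. p m * measure \<mu> (s m -` A))"
    and p_pos: "m \<in> J \<Longrightarrow> 0 < p m"
    and p_sum: "sum p J = 1"
    and osc: "\<exists>U. open U \<and> U \<noteq> {} \<and> (\<forall>m\<in>J. s m ` U \<subseteq> U) \<and>
          (\<forall>m\<in>J. \<forall>m'\<in>J. m \<noteq> m' \<longrightarrow> s m ` U \<inter> s m' ` U = {})"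
begin

sublocale finite_measure \<mu> by (rule finite_\<mu>)

lemma space_\<mu> [simp]: "space \<mu> = UNIV"
  using sets_eq_imp_space_eq[OF sets_\<mu>] by simp

lemma measure_off_attractor: "A \<in> sets borel \<Longrightarrow> A \<inter> \<Gamma> = {} \<Longrightarrow> measure \<mu> A = 0"
proof -
  assume A: "A \<in> sets borel" "A \<inter> \<Gamma> = {}"
  have "- \<Gamma> \<in> sets \<mu>" using compact_attractor by (auto simp: sets_\<mu> compact_imp_closed)
  then have "emeasure \<mu> A \<le> emeasure \<mu> (- \<Gamma>)" using A(2) by (intro emeasure_mono) auto
  then show ?thesis using supported by (simp add: measure_def)
qed

lemma measure_attractor: "measure \<mu> \<Gamma> = measure \<mu> UNIV" "0 < measure \<mu> \<Gamma>"
proof -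
  have G: "\<Gamma> \<in> sets \<mu>" using compact_attractor by (auto simp: sets_\<mu> compact_imp_closed)
  have "- \<Gamma> \<in> sets borel" using G by (auto simp: sets_\<mu>)
  then have "measure \<mu> (- \<Gamma>) = 0" by (intro measure_off_attractor) auto
  moreover have "measure \<mu> (UNIV - \<Gamma>) = measure \<mu> UNIV - measure \<mu> \<Gamma>"
    using finite_measure_compl[OF G] by simp
  ultimately show eq: "measure \<mu> \<Gamma> = measure \<mu> UNIV" by (simp add: Compl_eq_Diff_UNIV)
  have "measure \<mu> UNIV \<noteq> 0" using \<mu>_nonzero by (simp add: emeasure_eq_measure)
  then show "0 < measure \<mu> \<Gamma>" using eq by (simp add: less_le)
qed

lemma vimage_compose_borel:
  "w \<in> words \<Longrightarrow> A \<in> sets borel \<Longrightarrow> compose_maps s w -` A \<in> sets borel"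
  using measurable_sets[OF borel_measurable_continuous_onI[OF continuous_compose[of w UNIV]], of A]
  by simp

lemma cell_borel: "w \<in> words \<Longrightarrow> cell s \<Gamma> w \<in> sets borel"
  using compact_cell by (auto intro: borel_compact)

lemma measure_vimage_harmonic:
  assumes "w \<in> words" "A \<in> sets borel"
  shows "measure \<mu> (compose_maps s w -` A)
    = (\<Sum>m\<in>J. p m * measure \<mu> (compose_maps s (w @ [m]) -` A))"
proof -
  have "s m -` (compose_maps s w -` A) = compose_maps s (w @ [m]) -` A" for m by auto
  then show ?thesis using invariant[OF vimage_compose_borel[OF assms]] by simp
qed

text \<open>Invariance along the letters of \<open>w\<close> gives \<open>\<mu>(\<Gamma>\<^sub>w) \<ge> p\<^sub>w \<mu>(\<Gamma>)\<close>, the other terms of the sums being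
  nonnegative. Without positivity the barycentre would be a division by zero.\<close>

lemma measure_cell_pos:
  assumes "w \<in> words" shows "0 < measure \<mu> (cell s \<Gamma> w)"
proof -
  have "0 < measure \<mu> (compose_maps s v -` cell s \<Gamma> (v @ u))" if "v @ u \<in> words" for v u
    using that
  proof (induction u arbitrary: v)
    case Nil
    have "measure \<mu> \<Gamma> \<le> measure \<mu> (compose_maps s v -` cell s \<Gamma> (v @ []))"
      using Nil vimage_compose_borel[of v] cell_borel[of v]
      by (intro finite_measure_mono) (auto simp: cell_def sets_\<mu>)
    then show ?case using measure_attractor(2) by linarith
  next
    case (Cons m u)
    let ?A = "cell s \<Gamma> (v @ m # u)"
    have "0 < p m * measure \<mu> (compose_maps s (v @ [m]) -` ?A)"
      using Cons.IH[of "v @ [m]"] Cons.prems p_pos[of m] by (intro mult_pos_pos) (simp_all del: compose_maps_append)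
    also have "\<dots> \<le> (\<Sum>m\<in>J. p m * measure \<mu> (compose_maps s (v @ [m]) -` ?A))"
      using Cons.prems p_pos finite_J
      by (intro member_le_sum[where f = "\<lambda>m. p m * measure \<mu> (compose_maps s (v @ [m]) -` ?A)"])
        (auto intro!: mult_nonneg_nonneg intro: less_imp_le)
    also have "\<dots> = measure \<mu> (compose_maps s v -` ?A)"
      using Cons.prems by (intro measure_vimage_harmonic[symmetric] cell_borel) auto
    finally show ?case .
  qed
  from this[of "[]" w] assms show ?thesis by simp
qed

text \<open>With \<open>A = \<Gamma>\<^sub>v \<inter> \<Gamma>\<^sub>w\<close>, the function \<open>i \<mapsto> \<mu>(s\<^sub>i\<inverse>(A))\<close> vanishes on all words incomparable to
  \<open>v\<close> or to \<open>w\<close>: they stay so under extension, and after appending a detached word the cell misses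
  \<open>A\<close>. Every word as long as \<open>v\<close> and \<open>w\<close> is of this kind, since it cannot extend both; invariance
  then carries the value \<open>0\<close> back to the empty word.\<close>

lemma measure_cell_overlap:
  assumes vw: "v \<in> words" "w \<in> words" "v \<parallel> w"
  shows "measure \<mu> (cell s \<Gamma> v \<inter> cell s \<Gamma> w) = 0"
proof -
  obtain U where U: "open U" "U \<noteq> {}" "\<forall>m\<in>J. s m ` U \<subseteq> U"
    "\<forall>m\<in>J. \<forall>m'\<in>J. m \<noteq> m' \<longrightarrow> s m ` U \<inter> s m' ` U = {}"
    using osc by (elim exE conjE)
  obtain k where k: "k \<in> words"
    "\<And>i j. i \<in> words \<Longrightarrow> j \<in> words \<Longrightarrow> i \<parallel> j \<Longrightarrow> cell s \<Gamma> (i @ k) \<inter> cell s \<Gamma> j = {}"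
    by (rule detached_word[OF U(1,2) U(3)[rule_format] U(4)[rule_format]]) (assumption+, rule that)
  define A where "A = cell s \<Gamma> v \<inter> cell s \<Gamma> w"
  define g where "g i = measure \<mu> (compose_maps s i -` A)" for i
  have A: "A \<in> sets borel" using cell_borel vw by (simp add: A_def sets.Int)
  define X where "X = {i \<in> words. i \<parallel> v \<or> i \<parallel> w}"
  have on_X: "g i = 0" if "i \<in> X" for i
  proof (rule harmonic_on_words_eq_0[where g = g and X = X and J = J and p = p and k = k])
    show "g j = (\<Sum>m\<in>J. p m * g (j @ [m]))" if "j \<in> X" for j
      using that A unfolding g_def X_def by (intro measure_vimage_harmonic) auto
    show "g j \<le> measure \<mu> UNIV" for j
      using bounded_measure by (simp add: g_def)
    show "g (j @ k) = 0" if "j \<in> X" for j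
    proof -
      have "cell s \<Gamma> (j @ k) \<inter> A = {}" using that k(2)[of j v] k(2)[of j w] vw
        by (auto simp: X_def A_def)
      then have "compose_maps s (j @ k) -` A \<inter> \<Gamma> = {}" by (auto simp: cell_def)
      then show ?thesis
        using that k A unfolding g_def X_def
        by (intro measure_off_attractor vimage_compose_borel) auto
    qed
    show "j @ [m] \<in> X" if "j \<in> X" "m \<in> J" for j m
      using that by (auto simp: X_def parallel_appendI intro: parallel_append)
  qed (use finite_J p_pos p_sum k that in \<open>auto simp: g_def\<close>)
  have "g i = 0" if "i \<in> words" "length i + n = max (length v) (length w)" for i n
    using that
  proof (induction n arbitrary: i)
    case 0
    have "i \<parallel> v \<or> i \<parallel> w"
    proof (rule ccontr)
      assume "\<not> (i \<parallel> v \<or> i \<parallel> w)"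
      moreover have "prefix u i" if "\<not> i \<parallel> u" "length u \<le> length i" for u
      proof -
        have "prefix i u \<or> prefix u i" using that(1) by blast
        then show ?thesis using that(2) by (auto simp: prefix_def)
      qed
      ultimately have "prefix v i" "prefix w i" using 0 by auto
      then have "\<not> v \<parallel> w" using prefix_same_cases by (auto simp: parallel_def)
      then show False using vw by simp
    qed
    then show ?case using 0 on_X by (simp add: X_def)
  next
    case (Suc n)
    have "g (i @ [m]) = 0" if "m \<in> J" for m using Suc that by (intro Suc.IH) auto
    then show ?case unfolding g_def using measure_vimage_harmonic[OF Suc.prems(1) A]
      by (simp add: sum.neutral)
  qed
  from this[of "[]"] show ?thesis by (simp add: g_def A_def)
qed

section \<open>Error of the barycentre rule in terms of local remainders\<close>

lemma set_integrable_cell: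
  fixes g :: "real^'n \<Rightarrow> 'z::{banach,second_countable_topology}"
  assumes w: "w \<in> words" and g: "continuous_on \<Gamma> g"
  shows "set_integrable \<mu> (cell s \<Gamma> w) g"
proof -
  have c: "continuous_on (cell s \<Gamma> w) g"
    using continuous_on_subset[OF g cell_subset[OF w]] .
  have "bounded (g ` cell s \<Gamma> w)"
    using compact_continuous_image[OF c compact_cell[OF w]] by (rule compact_imp_bounded)
  then obtain B where B: "\<And>x. x \<in> cell s \<Gamma> w \<Longrightarrow> norm (g x) \<le> B" by (auto simp: bounded_iff)
  have "(\<lambda>x. indicator (cell s \<Gamma> w) x *\<^sub>R g x) \<in> borel_measurable \<mu>"
    using borel_measurable_continuous_on_indicator[OF cell_borel[OF w] c]
    by (simp cong: measurable_cong_sets add: sets_\<mu>)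
  moreover have "norm (indicator (cell s \<Gamma> w) x *\<^sub>R g x) \<le> max B 0" for x
    using B[of x] by (auto simp: indicator_def)
  ultimately show ?thesis
    unfolding set_integrable_def by (intro integrable_const_bound[where B = "max B 0"]) auto
qed

text \<open>The linear term integrates to \<open>0\<close> over each cell by the definition of the barycentre.\<close>

lemma error_le_linear_remainder:
  assumes L: "finite L" "L \<subseteq> words" "pairwise (\<parallel>) L" "\<Gamma> = (\<Union>w\<in>L. cell s \<Gamma> w)"
    and f: "continuous_on \<Gamma> f"
    and rem: "\<And>w. w \<in> L \<Longrightarrow> \<exists>D::real^'n \<Rightarrow> complex. bounded_linear D \<and>
      (\<forall>x\<in>cell s \<Gamma> w. norm (f x - f (barycentre \<mu> (cell s \<Gamma> w)) - D (x - barycentre \<mu> (cell s \<Gamma> w))) \<le> K)"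
  shows "norm ((LINT x:\<Gamma>|\<mu>. f x) - (\<Sum>w\<in>L. complex_of_real (measure \<mu> (cell s \<Gamma> w)) *
      f (barycentre \<mu> (cell s \<Gamma> w)))) \<le> K * measure \<mu> \<Gamma>"
proof -
  let ?c = "cell s \<Gamma>" and ?b = "\<lambda>w. barycentre \<mu> (cell s \<Gamma> w)"
  have words: "w \<in> words" if "w \<in> L" for w using that L(2) by auto
  have meas: "?c w \<in> sets \<mu>" if "w \<in> L" for w using cell_borel[OF words[OF that]] by (simp add: sets_\<mu>)
  have ae: "AE x in \<mu>. x \<notin> ?c v \<or> x \<notin> ?c w" if "v \<in> L" "w \<in> L" "v \<noteq> w" for v w
  proof -
    have "emeasure \<mu> (?c v \<inter> ?c w) = 0"
      using measure_cell_overlap[OF words words] that L(3) by (simp add: emeasure_eq_measure pairwise_def)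
    then show ?thesis
      using AE_not_in[of "?c v \<inter> ?c w" \<mu>] meas that by (auto simp: null_sets_def)
  qed
  have int: "set_integrable \<mu> (?c w) g" if "w \<in> L" "continuous_on \<Gamma> g" for w
    and g :: "real^'n \<Rightarrow> 'z::{banach,second_countable_topology}"
    using set_integrable_cell words that by blast
  have split: "(LINT x:\<Gamma>|\<mu>. f x) = (\<Sum>w\<in>L. LINT x:?c w|\<mu>. f x)"
    by (subst L(4), intro set_integral_finite_UN_AE L(1) meas int f) (use ae in fastforce)
  have total: "measure \<mu> \<Gamma> = (\<Sum>w\<in>L. measure \<mu> (?c w))"
    by (subst L(4), intro measure_UNION_AE L(1))
      (use ae meas in \<open>auto simp: pairwise_def fmeasurable_eq_sets\<close>)
  have cell_error: "norm ((LINT x:?c w|\<mu>. f x) - complex_of_real (measure \<mu> (?c w)) * f (?b w)) \<le> K * measure \<mu> (?c w)"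
    if w: "w \<in> L" for w
  proof -
    obtain D where D: "bounded_linear D" "\<And>x. x \<in> ?c w \<Longrightarrow> norm (f x - f (?b w) - D (x - ?b w)) \<le> K"
      using rem[OF w] by blast
    interpret D: bounded_linear D by (rule D)
    have pos: "0 < measure \<mu> (?c w)" using measure_cell_pos[OF words[OF w]] .
    have const: "(LINT x:?c w|\<mu>. z) = measure \<mu> (?c w) *\<^sub>R z"
      for z :: "'z::{banach,second_countable_topology}"
    proof -
      have "integrable \<mu> (indicator (?c w) :: _ \<Rightarrow> real)"
        using meas[OF w] by (simp add: integrable_real_indicator emeasure_eq_measure)
      then show ?thesis using meas[OF w] by (simp add: set_lebesgue_integral_def integral_scaleR_left)
    qed
    have i: "set_integrable \<mu> (?c w) f" "set_integrable \<mu> (?c w) (\<lambda>x. x)"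
      "set_integrable \<mu> (?c w) (\<lambda>x. f (?b w))" "set_integrable \<mu> (?c w) (\<lambda>x. x - ?b w)"
      "set_integrable \<mu> (?c w) (\<lambda>x. D (x - ?b w))"
      "set_integrable \<mu> (?c w) (\<lambda>x. f x - f (?b w) - D (x - ?b w))"
      by (intro int w f continuous_intros D.continuous_on)+
    have "(LINT x:?c w|\<mu>. D (x - ?b w)) = D (LINT x:?c w|\<mu>. x - ?b w)"
      using integral_bounded_linear[OF D(1) i(4)[unfolded set_integrable_def]]
      by (simp add: set_lebesgue_integral_def D.scaleR)
    also have "(LINT x:?c w|\<mu>. x - ?b w) = (LINT x:?c w|\<mu>. x) - measure \<mu> (?c w) *\<^sub>R ?b w"
      using int[OF w, of "\<lambda>x. ?b w"] i(2) by (subst set_integral_diff) (auto simp: const)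
    also have "\<dots> = 0" using pos by (simp add: barycentre_def)
    finally have "(LINT x:?c w|\<mu>. f x) - complex_of_real (measure \<mu> (?c w)) * f (?b w)
        = (LINT x:?c w|\<mu>. f x - f (?b w) - D (x - ?b w))"
      using i by (simp add: set_integral_diff const scaleR_conv_of_real)
    also have "norm \<dots> \<le> (LINT x:?c w|\<mu>. norm (f x - f (?b w) - D (x - ?b w)))"
      by (rule set_integral_norm_bound) (rule i)
    also have "\<dots> \<le> (LINT x:?c w|\<mu>. K)"
      using i(6) D(2) int[OF w, of "\<lambda>x. K"] by (intro set_integral_mono set_integrable_norm) auto
    finally show ?thesis by (simp add: const mult.commute)
  qed
  have "norm ((LINT x:\<Gamma>|\<mu>. f x) - (\<Sum>w\<in>L. complex_of_real (measure \<mu> (?c w)) * f (?b w)))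
      \<le> (\<Sum>w\<in>L. norm ((LINT x:?c w|\<mu>. f x) - complex_of_real (measure \<mu> (?c w)) * f (?b w)))"
    unfolding split sum_subtractf[symmetric] by (rule norm_sum)
  also have "\<dots> \<le> (\<Sum>w\<in>L. K * measure \<mu> (?c w))" by (intro sum_mono cell_error)
  finally show ?thesis by (simp add: total sum_distrib_left)
qed

end

text \<open>A hyperplane separating the mean from \<open>C\<close> would give a linear functional that is larger than its
  own mean everywhere on \<open>A\<close>.\<close>

lemma barycentre_mem_convex:
  assumes "finite_measure \<mu>" "A \<in> sets \<mu>" "measure \<mu> A > 0" "set_integrable \<mu> A (\<lambda>x. x)"
    and C: "A \<subseteq> C" "convex C" "closed C"
  shows "barycentre \<mu> A \<in> C"
proof (rule ccontr)
  interpret finite_measure \<mu> by fact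
  assume "barycentre \<mu> A \<notin> C"
  then obtain a b where ab: "a \<bullet> barycentre \<mu> A < b" "\<And>x. x \<in> C \<Longrightarrow> b < a \<bullet> x"
    using separating_hyperplane_closed_point[OF C(2,3)] by metis
  have fin: "emeasure \<mu> A < \<infinity>" by (simp add: emeasure_eq_measure)
  have "measure \<mu> A * b = (LINT x:A|\<mu>. b)"
    using fin assms(2) by (simp add: set_lebesgue_integral_def emeasure_eq_measure)
  also have "\<dots> \<le> (LINT x:A|\<mu>. a \<bullet> x)"
  proof (rule set_integral_mono)
    show "set_integrable \<mu> A (\<lambda>x. b)" using assms(2) fin by (simp add: set_integrable_def)
    show "set_integrable \<mu> A (\<lambda>x. a \<bullet> x)"
      using integrable_inner_right[of a \<mu>, OF assms(4)[unfolded set_integrable_def]]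
      by (simp add: set_integrable_def)
    show "b \<le> a \<bullet> x" if "x \<in> A" for x using ab(2) C(1) that by force
  qed
  also have "\<dots> = a \<bullet> (LINT x:A|\<mu>. x)"
    using integral_inner_right[of a \<mu>, OF assms(4)[unfolded set_integrable_def]]
    by (simp add: set_lebesgue_integral_def)
  also have "\<dots> = measure \<mu> A * (a \<bullet> barycentre \<mu> A)"
    using assms(3) by (simp add: barycentre_def)
  also have "\<dots> < measure \<mu> A * b" using ab(1) assms(3) by simp
  finally show False by simp
qed

section \<open>Gradients and Lipschitz constants\<close>

lemma partial_deriv_eq:
  assumes "(f has_derivative D) (at x)" shows "partial_deriv i f x = D (axis i 1)"
proof -
  interpret D: bounded_linear D using assms by (rule has_derivative_bounded_linear)
  have "((\<lambda>t::real. x + t *\<^sub>R axis i 1) has_derivative (\<lambda>t. t *\<^sub>R axis i 1)) (at 0)"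
    by (auto intro!: derivative_eq_intros)
  from has_derivative_compose[OF this, of f D]
  have "((\<lambda>t. f (x + t *\<^sub>R axis i 1)) has_vector_derivative D (axis i 1)) (at 0)"
    using assms by (simp add: has_vector_derivative_def D.scaleR)
  then show ?thesis unfolding partial_deriv_def by (rule vector_derivative_at)
qed

lemma linear_eq_sum_axis:
  fixes D :: "real^'n \<Rightarrow> 'b::real_vector"
  assumes "linear D" shows "D v = (\<Sum>i\<in>UNIV. v $ i *\<^sub>R D (axis i 1))"
proof -
  have "D v = D (\<Sum>i\<in>UNIV. v $ i *\<^sub>R axis i 1)"
    using basis_expansion[of v] by (simp add: scalar_mult_eq_scaleR)
  then show ?thesis using assms by (simp add: linear_sum linear_scale)
qed

lemma norm_sum_scaleR_le:
  fixes v :: "real^'n" and w :: "'b::real_normed_vector^'n"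
  shows "norm (\<Sum>i\<in>UNIV. v $ i *\<^sub>R w $ i) \<le> norm v * norm w"
proof -
  have "norm (\<Sum>i\<in>UNIV. v $ i *\<^sub>R w $ i) \<le> (\<Sum>i\<in>UNIV. \<bar>v $ i\<bar> * \<bar>norm (w $ i)\<bar>)"
    by (rule order_trans[OF norm_sum]) simp
  also have "\<dots> \<le> norm v * norm w"
    using L2_set_mult_ineq[of "\<lambda>i. v $ i" "\<lambda>i. norm (w $ i)" UNIV] by (simp add: norm_vec_def L2_set_def)
  finally show ?thesis .
qed

lemma has_derivative_gradient:
  assumes "f differentiable (at x)"
  shows "(f has_derivative (\<lambda>v. \<Sum>i\<in>UNIV. v $ i *\<^sub>R gradient f x $ i)) (at x)"
proof -
  obtain D where D: "(f has_derivative D) (at x)" using assms by (auto simp: differentiable_def)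
  then have "D = (\<lambda>v. \<Sum>i\<in>UNIV. v $ i *\<^sub>R gradient f x $ i)"
    unfolding gradient_def vec_lambda_beta partial_deriv_eq[OF D]
    by (intro ext linear_eq_sum_axis has_derivative_linear[OF D])
  with D show ?thesis by simp
qed

lemma lip0_boundD:
  assumes "lip0 E f \<le> ennreal K" "0 \<le> K" "x \<in> E" "y \<in> E"
  shows "norm (f x - f y) \<le> K * norm (x - y)"
proof (cases "x = y")
  case False
  have "ennreal (norm (f x - f y) / norm (x - y)) \<le> lip0 E f"
    unfolding lip0_def using assms False
    by (intro SUP_upper2[of "(x, y)"]) auto
  then have "norm (f x - f y) / norm (x - y) \<le> K"
    using assms(1,2) by (metis ennreal_le_iff order_trans)
  then show ?thesis using False by (simp add: pos_divide_le_eq)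
qed simp

lemma lip0_leI:
  assumes "\<And>x y. x \<in> E \<Longrightarrow> y \<in> E \<Longrightarrow> norm (f x - f y) \<le> K * norm (x - y)"
  shows "lip0 E f \<le> ennreal K"
  unfolding lip0_def
proof (rule SUP_least, clarify)
  fix x y assume "x \<in> E" "y \<in> E" "x \<noteq> y"
  then show "ennreal (norm (f x - f y) / norm (x - y)) \<le> ennreal K"
    using assms[of x y] by (intro ennreal_leI) (simp add: pos_divide_le_eq)
qed

lemma lip0_le_SUP_derivative:
  fixes g :: "real^'n \<Rightarrow> 'b::real_normed_vector"
  assumes C: "convex C" "C \<subseteq> S"
    and g: "\<And>x. x \<in> C \<Longrightarrow> (g has_derivative g' x) (at x)"
    and N: "\<And>x v. x \<in> C \<Longrightarrow> norm (g' x v) \<le> N x * norm v" "\<And>x. 0 \<le> N x"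
  shows "lip0 C g \<le> (SUP x\<in>S. ennreal (N x))"
proof (cases "(SUP x\<in>S. ennreal (N x))")
  case (real B)
  have "N x \<le> B" if "x \<in> C" for x
    using SUP_upper[of x S "\<lambda>x. ennreal (N x)"] that C(2) real by (auto simp: ennreal_le_iff)
  then have "norm (g' x v) \<le> B * norm v" if "x \<in> C" for x v
    using that by (intro order_trans[OF N(1)] mult_right_mono) auto
  then have "onorm (g' x) \<le> B" if "x \<in> C" for x
    using that real by (intro onorm_bound) auto
  then have "norm (g x - g y) \<le> B * norm (x - y)" if "x \<in> C" "y \<in> C" for x y
    using that by (intro differentiable_bound[OF C(1) has_derivative_at_withinI[OF g]])
  then show ?thesis unfolding real by (rule lip0_leI)
next
  case top
  show ?thesis unfolding top by simp
qed

text \<open>Along the segment from \<open>a\<close> to \<open>x\<close> the derivative of \<open>f\<close> minus its linearisation at \<open>a\<close> has norm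
  at most \<open>K t |x - a|\<^sup>2\<close>. The mean value inequality with majorant \<open>K |x - a|\<^sup>2 t\<^sup>2 / 2\<close> gives
  the factor \<open>1/2\<close>; it applies to complex values, for which the Lagrange form of the remainder
  fails.\<close>

lemma taylor_remainder_lip1:
  fixes f :: "real^'n \<Rightarrow> complex"
  assumes C: "convex C" "a \<in> C" "x \<in> C"
    and f: "\<And>y. y \<in> C \<Longrightarrow> f differentiable (at y)"
    and K: "lip1 C f \<le> ennreal K" "0 \<le> K"
  shows "norm (f x - f a - (\<Sum>i\<in>UNIV. (x - a) $ i *\<^sub>R gradient f a $ i)) \<le> K / 2 * (norm (x - a))\<^sup>2"
proof -
  define v where "v = x - a"
  define F where "F y = (\<Sum>i\<in>UNIV. v $ i *\<^sub>R gradient f y $ i)" for y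
  have line: "a + t *\<^sub>R v \<in> C" if "0 \<le> t" "t \<le> 1" for t
    using convexD_alt[OF C that] by (simp add: v_def algebra_simps)
  have d: "((\<lambda>t. f (a + t *\<^sub>R v) - t *\<^sub>R F a) has_vector_derivative F (a + t *\<^sub>R v) - F a) (at t)"
    if "0 \<le> t" "t \<le> 1" for t
  proof -
    have 1: "((\<lambda>t. a + t *\<^sub>R v) has_derivative (\<lambda>h. h *\<^sub>R v)) (at t)"
      by (auto intro!: derivative_eq_intros)
    have "((\<lambda>t. f (a + t *\<^sub>R v)) has_vector_derivative F (a + t *\<^sub>R v)) (at t)"
      using has_derivative_compose[OF 1 has_derivative_gradient[OF f[OF line[OF that]]]]
      by (simp add: has_vector_derivative_def F_def scaleR_sum_right)
    then show ?thesis by (auto intro!: derivative_eq_intros)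
  qed
  have "norm ((f (a + 1 *\<^sub>R v) - 1 *\<^sub>R F a) - (f (a + 0 *\<^sub>R v) - 0 *\<^sub>R F a))
      \<le> K / 2 * (norm v)\<^sup>2 * 1\<^sup>2 - K / 2 * (norm v)\<^sup>2 * 0\<^sup>2"
  proof (rule differentiable_bound_general[where f = "\<lambda>t. f (a + t *\<^sub>R v) - t *\<^sub>R F a"
        and \<phi> = "\<lambda>t. K / 2 * (norm v)\<^sup>2 * t\<^sup>2"])
    show "continuous_on {0..1} (\<lambda>t. f (a + t *\<^sub>R v) - t *\<^sub>R F a)"
      using d by (intro continuous_at_imp_continuous_on ballI has_vector_derivative_continuous) auto
    show "((\<lambda>t. f (a + t *\<^sub>R v) - t *\<^sub>R F a) has_vector_derivative F (a + t *\<^sub>R v) - F a) (at t)"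
      if "0 < t" "t < 1" for t using d that by simp
    show "((\<lambda>t. K / 2 * (norm v)\<^sup>2 * t\<^sup>2) has_vector_derivative K * (norm v)\<^sup>2 * t) (at t)" for t
      by (auto intro!: derivative_eq_intros simp: has_real_derivative_iff_has_vector_derivative[symmetric])
    show "norm (F (a + t *\<^sub>R v) - F a) \<le> K * (norm v)\<^sup>2 * t" if t: "0 < t" "t < 1" for t
    proof -
      have "F (a + t *\<^sub>R v) - F a = (\<Sum>i\<in>UNIV. v $ i *\<^sub>R (gradient f (a + t *\<^sub>R v) - gradient f a) $ i)"
        by (simp add: F_def sum_subtractf scaleR_diff_right)
      also have "norm \<dots> \<le> norm v * norm (gradient f (a + t *\<^sub>R v) - gradient f a)"
        by (rule norm_sum_scaleR_le)
      also have "\<dots> \<le> norm v * (K * norm ((a + t *\<^sub>R v) - a))"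
        using t by (intro mult_left_mono lip0_boundD[OF K[unfolded lip1_def]] line C) auto
      finally show ?thesis using t by (simp add: power2_eq_square mult_ac)
    qed
  qed (auto intro!: continuous_intros)
  then show ?thesis by (simp add: v_def F_def algebra_simps)
qed

section \<open>Hessians and derivatives of order two\<close>

text \<open>The second difference over the parallelogram spanned by \<open>t u\<close> and \<open>t w\<close> is the increment of
  \<open>\<sigma> \<mapsto> f(x + \<sigma> u + t w) - f(x + \<sigma> u)\<close> over \<open>[0, t]\<close>, whose derivative is \<open>t A w + o(t)\<close>
  uniformly in \<open>\<sigma>\<close> because \<open>F(y)u\<close> is differentiable at \<open>x\<close>.\<close>

lemma second_difference_estimate:
  fixes f :: "'a::real_normed_vector \<Rightarrow> 'b::real_normed_vector"
  assumes \<Omega>: "open \<Omega>" "x \<in> \<Omega>"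
    and F: "\<And>y. y \<in> \<Omega> \<Longrightarrow> (f has_derivative F y) (at y)"
    and A: "((\<lambda>y. F y u) has_derivative A) (at x)"
    and \<epsilon>: "0 < \<epsilon>"
  shows "\<forall>\<^sub>F t in at_right 0. norm (f (x + t *\<^sub>R u + t *\<^sub>R w) - f (x + t *\<^sub>R u) - f (x + t *\<^sub>R w) + f x
      - t\<^sup>2 *\<^sub>R A w) \<le> \<epsilon> * t\<^sup>2"
proof -
  interpret A: bounded_linear A using A by (rule has_derivative_bounded_linear)
  define c where "c = norm u + norm w + 1"
  have c: "0 < c" unfolding c_def using norm_ge_zero[of u] norm_ge_zero[of w] by linarith
  define e where "e = \<epsilon> / (2 * c)"
  have e: "0 < e" using c \<epsilon> by (simp add: e_def)
  obtain d1 where d1: "0 < d1" "\<And>y. norm (y - x) < d1 \<Longrightarrow> norm (F y u - F x u - A (y - x)) \<le> e * norm (y - x)"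
    using A e unfolding has_derivative_at_alt by blast
  obtain d2 where d2: "0 < d2" "ball x d2 \<subseteq> \<Omega>" using \<Omega> openE by blast
  \<comment> \<open>For \<open>\<sigma>, \<tau> \<in> [0, t]\<close> the point \<open>\<sigma> u + \<tau> w\<close> has norm at most \<open>t c\<close>. The estimate of \<open>g'\<close> below
      uses the error \<open>e t c\<close> twice, hence \<open>e = \<epsilon> / (2 c)\<close>.\<close>
  define d where "d = min d1 d2 / c"
  have d: "0 < d" using d1 d2 c by (simp add: d_def)
  have "norm (f (x + t *\<^sub>R u + t *\<^sub>R w) - f (x + t *\<^sub>R u) - f (x + t *\<^sub>R w) + f x - t\<^sup>2 *\<^sub>R A w) \<le> \<epsilon> * t\<^sup>2"
    if t: "0 < t" "t < d" for t
  proof -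
    have small: "norm (\<sigma> *\<^sub>R u + \<tau> *\<^sub>R w) \<le> t * c" "norm (\<sigma> *\<^sub>R u + \<tau> *\<^sub>R w) < min d1 d2"
      if "0 \<le> \<sigma>" "\<sigma> \<le> t" "0 \<le> \<tau>" "\<tau> \<le> t" for \<sigma> \<tau>
    proof -
      have "norm (\<sigma> *\<^sub>R u + \<tau> *\<^sub>R w) \<le> \<sigma> * norm u + \<tau> * norm w"
        using that norm_triangle_ineq[of "\<sigma> *\<^sub>R u" "\<tau> *\<^sub>R w"] by simp
      also have "\<dots> \<le> t * norm u + t * norm w" using that by (intro add_mono mult_right_mono) auto
      also have "\<dots> \<le> t * c" using t by (simp add: c_def algebra_simps)
      finally show 1: "norm (\<sigma> *\<^sub>R u + \<tau> *\<^sub>R w) \<le> t * c" .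
      have "t * c < d * c" using t c by simp
      also have "d * c = min d1 d2" using c by (simp add: d_def)
      finally show "norm (\<sigma> *\<^sub>R u + \<tau> *\<^sub>R w) < min d1 d2" using 1 by linarith
    qed
    define g where "g \<sigma> = f (x + (\<sigma> *\<^sub>R u + t *\<^sub>R w)) - f (x + (\<sigma> *\<^sub>R u + 0 *\<^sub>R w)) - (\<sigma> * t) *\<^sub>R A w" for \<sigma>
    define g' where "g' \<sigma> = F (x + (\<sigma> *\<^sub>R u + t *\<^sub>R w)) u - F (x + (\<sigma> *\<^sub>R u + 0 *\<^sub>R w)) u - t *\<^sub>R A w" for \<sigma>
    have fd: "((\<lambda>\<sigma>. f (x + (\<sigma> *\<^sub>R u + \<tau> *\<^sub>R w))) has_vector_derivative F (x + (\<sigma> *\<^sub>R u + \<tau> *\<^sub>R w)) u) (at \<sigma>)"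
      if "0 \<le> \<sigma>" "\<sigma> \<le> t" "0 \<le> \<tau>" "\<tau> \<le> t" for \<sigma> \<tau>
    proof -
      have in\<Omega>: "x + (\<sigma> *\<^sub>R u + \<tau> *\<^sub>R w) \<in> \<Omega>"
      proof -
        have d_add: "dist x (x + h) = norm h" for h by (simp add: dist_norm)
        have "x + (\<sigma> *\<^sub>R u + \<tau> *\<^sub>R w) \<in> ball x d2"
          using small(2)[OF that] d_add[of "\<sigma> *\<^sub>R u + \<tau> *\<^sub>R w"] by (simp only: mem_ball)
        with d2(2) show ?thesis by blast
      qed
      have 1: "((\<lambda>\<sigma>. x + (\<sigma> *\<^sub>R u + \<tau> *\<^sub>R w)) has_derivative (\<lambda>h. h *\<^sub>R u)) (at \<sigma>)"
        by (auto intro!: derivative_eq_intros)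
      show ?thesis
        using has_derivative_compose[OF 1 F[OF in\<Omega>]] linear_scale[OF has_derivative_linear[OF F[OF in\<Omega>]]]
        by (simp add: has_vector_derivative_def)
    qed
    have gd: "(g has_vector_derivative g' \<sigma>) (at \<sigma>)" if "0 \<le> \<sigma>" "\<sigma> \<le> t" for \<sigma>
      unfolding g_def g'_def using that t
      by (intro has_vector_derivative_diff fd) (auto intro!: derivative_eq_intros)
    have bound: "norm (g' \<sigma>) \<le> \<epsilon> * t" if s: "0 \<le> \<sigma>" "\<sigma> \<le> t" for \<sigma>
    proof -
      define R where "R h = F (x + h) u - F x u - A h" for h
      have R: "norm (R (\<sigma> *\<^sub>R u + \<tau> *\<^sub>R w)) \<le> e * (t * c)" if "0 \<le> \<tau>" "\<tau> \<le> t" for \<tau>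
      proof -
        have "norm (R (\<sigma> *\<^sub>R u + \<tau> *\<^sub>R w)) \<le> e * norm (\<sigma> *\<^sub>R u + \<tau> *\<^sub>R w)"
          using d1(2)[of "x + (\<sigma> *\<^sub>R u + \<tau> *\<^sub>R w)"] small(2)[OF s that] by (simp add: R_def)
        also have "\<dots> \<le> e * (t * c)" using small(1)[OF s that] e by (intro mult_left_mono) auto
        finally show ?thesis .
      qed
      have "g' \<sigma> = R (\<sigma> *\<^sub>R u + t *\<^sub>R w) - R (\<sigma> *\<^sub>R u + 0 *\<^sub>R w)"
        by (simp add: g'_def R_def A.add A.scaleR)
      also have "norm \<dots> \<le> e * (t * c) + e * (t * c)"
        using R[of t] R[of 0] t by (intro order_trans[OF norm_triangle_ineq4] add_mono) auto
      also have "\<dots> = \<epsilon> * t" using c by (simp add: e_def field_simps)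
      finally show ?thesis .
    qed
    have "norm (g t - g 0) \<le> \<epsilon> * t * t - \<epsilon> * t * 0"
    proof (rule differentiable_bound_general[where f = g and f' = g' and \<phi> = "\<lambda>\<sigma>. \<epsilon> * t * \<sigma>"])
      show "continuous_on {0..t} g"
        using gd by (intro continuous_at_imp_continuous_on ballI has_vector_derivative_continuous) auto
      show "((\<lambda>\<sigma>. \<epsilon> * t * \<sigma>) has_vector_derivative \<epsilon> * t) (at \<sigma>)" for \<sigma>
        by (auto intro!: derivative_eq_intros simp: has_real_derivative_iff_has_vector_derivative[symmetric])
    qed (use t gd bound in \<open>auto intro!: continuous_intros\<close>)
    moreover have "g t - g 0 = f (x + t *\<^sub>R u + t *\<^sub>R w) - f (x + t *\<^sub>R u) - f (x + t *\<^sub>R w) + f x - t\<^sup>2 *\<^sub>R A w"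
      by (simp add: g_def power2_eq_square add.assoc)
    ultimately show ?thesis by (simp add: power2_eq_square mult.assoc)
  qed
  then show ?thesis using d unfolding eventually_at_right_field by blast
qed

text \<open>The second difference is symmetric in \<open>u\<close> and \<open>w\<close>, and divided by \<open>t\<^sup>2\<close> it tends
  both to \<open>A w\<close> and to \<open>B u\<close>.\<close>

lemma second_derivative_symmetric:
  fixes f :: "'a::real_normed_vector \<Rightarrow> 'b::real_normed_vector"
  assumes \<Omega>: "open \<Omega>" "x \<in> \<Omega>"
    and F: "\<And>y. y \<in> \<Omega> \<Longrightarrow> (f has_derivative F y) (at y)"
    and A: "((\<lambda>y. F y u) has_derivative A) (at x)"
    and B: "((\<lambda>y. F y w) has_derivative B) (at x)"
  shows "A w = B u"
proof -
  have "norm (A w - B u) \<le> \<epsilon>" if "0 < \<epsilon>" for \<epsilon>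
  proof -
    have A': "\<forall>\<^sub>F t in at_right 0. norm (f (x + t *\<^sub>R u + t *\<^sub>R w) - f (x + t *\<^sub>R u) - f (x + t *\<^sub>R w) + f x
        - t\<^sup>2 *\<^sub>R A w) \<le> \<epsilon> / 2 * t\<^sup>2"
      using that F A by (intro second_difference_estimate[OF \<Omega>, where F = F and u = u and w = w and A = A]) auto
    have B': "\<forall>\<^sub>F t in at_right 0. norm (f (x + t *\<^sub>R w + t *\<^sub>R u) - f (x + t *\<^sub>R w) - f (x + t *\<^sub>R u) + f x
        - t\<^sup>2 *\<^sub>R B u) \<le> \<epsilon> / 2 * t\<^sup>2"
      using that F B by (intro second_difference_estimate[OF \<Omega>, where F = F and u = w and w = u and A = B]) auto
    have "\<forall>\<^sub>F t::real in at_right 0. norm (A w - B u) \<le> \<epsilon>"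
      using A' B' eventually_at_right_less[of 0]
    proof eventually_elim
      case (elim t)
      define \<Delta> where "\<Delta> = f (x + t *\<^sub>R u + t *\<^sub>R w) - f (x + t *\<^sub>R u) - f (x + t *\<^sub>R w) + f x"
      have "norm (\<Delta> - t\<^sup>2 *\<^sub>R A w) \<le> \<epsilon> / 2 * t\<^sup>2" using elim(1) by (simp add: \<Delta>_def)
      moreover have "norm (\<Delta> - t\<^sup>2 *\<^sub>R B u) \<le> \<epsilon> / 2 * t\<^sup>2" using elim(2) by (simp add: \<Delta>_def algebra_simps)
      ultimately have "norm ((\<Delta> - t\<^sup>2 *\<^sub>R B u) - (\<Delta> - t\<^sup>2 *\<^sub>R A w)) \<le> \<epsilon> * t\<^sup>2"
        using norm_triangle_ineq4[of "\<Delta> - t\<^sup>2 *\<^sub>R B u" "\<Delta> - t\<^sup>2 *\<^sub>R A w"] by linarith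
      moreover have "(\<Delta> - t\<^sup>2 *\<^sub>R B u) - (\<Delta> - t\<^sup>2 *\<^sub>R A w) = t\<^sup>2 *\<^sub>R (A w - B u)"
        by (simp add: algebra_simps)
      ultimately show ?case using elim(3) by (simp add: mult.commute)
    qed
    then show ?thesis by (simp add: eventually_const_iff)
  qed
  then have "norm (A w - B u) \<le> 0" by (rule field_le_epsilon[of _ 0, simplified])
  then show ?thesis by simp
qed

text \<open>The vector \<open>w\<close> is the transpose of \<open>H\<close> applied to \<open>v\<close>. With \<open>c\<close> the complex conjugate of \<open>w\<close>,
  \<open>|w|\<^sup>2 = \<Sum>\<^sub>i v\<^sub>i (H c)\<^sub>i \<le> |v| \<parallel>H\<parallel> |w|\<close>. The transpose appears
  because the derivative of the gradient in direction \<open>v\<close> has components \<open>\<Sum>\<^sub>i v\<^sub>i \<partial>\<^sub>i \<partial>\<^sub>j f\<close>, while \<open>i\<close>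
  is the row index of the Hessian.\<close>

lemma norm_transpose_mult_le:
  fixes H :: "complex^'n^'n" and v :: "real^'n" and w :: "complex^'n"
  assumes w: "\<And>j. w $ j = (\<Sum>i\<in>UNIV. v $ i *\<^sub>R H $ i $ j)"
  shows "norm w \<le> matrix_norm2 H * norm v"
proof -
  define c where "c = (\<chi> j. cnj (w $ j))"
  have c: "norm c = norm w" by (simp add: c_def norm_vec_def)
  have "complex_of_real ((norm w)\<^sup>2) = (\<Sum>j\<in>UNIV. c $ j * w $ j)"
    by (simp add: norm_vec_def L2_set_def c_def sum_nonneg complex_norm_square[symmetric] mult.commute[of "cnj _"])
  also have "\<dots> = (\<Sum>i\<in>UNIV. v $ i *\<^sub>R (H *v c) $ i)"
  proof -
    have "(\<Sum>j\<in>UNIV. c $ j * w $ j) = (\<Sum>j\<in>UNIV. \<Sum>i\<in>UNIV. v $ i *\<^sub>R (H $ i $ j * c $ j))"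
      by (simp add: w sum_distrib_left mult.commute)
    also have "\<dots> = (\<Sum>i\<in>UNIV. \<Sum>j\<in>UNIV. v $ i *\<^sub>R (H $ i $ j * c $ j))" by (rule sum.swap)
    finally show ?thesis by (simp add: matrix_vector_mult_def scaleR_sum_right)
  qed
  finally have "(norm w)\<^sup>2 = norm (\<Sum>i\<in>UNIV. v $ i *\<^sub>R (H *v c) $ i)"
    by (metis norm_of_real abs_power2 power2_abs abs_norm_cancel)
  also have "\<dots> \<le> norm v * norm (H *v c)" by (rule norm_sum_scaleR_le)
  also have "\<dots> \<le> norm v * (matrix_norm2 H * norm c)"
    unfolding matrix_norm2_def by (intro mult_left_mono onorm) auto
  finally have "norm w * norm w \<le> (matrix_norm2 H * norm v) * norm w"
    by (simp add: c power2_eq_square mult_ac)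
  moreover have "0 \<le> matrix_norm2 H"
    unfolding matrix_norm2_def by (intro onorm_pos_le) auto
  ultimately show ?thesis by (cases "norm w = 0") auto
qed

lemma matrix_norm2_le:
  fixes H :: "complex^'n^'n"
  assumes "\<And>i j. cmod (H $ i $ j) \<le> B" shows "matrix_norm2 H \<le> real CARD('n) * B"
proof -
  have B: "0 \<le> B" using assms[of undefined undefined] norm_ge_zero order_trans by blast
  show ?thesis
    unfolding matrix_norm2_def
  proof (rule onorm_bound)
    fix v :: "complex^'n"
    have row: "norm ((H *v v) $ i) \<le> sqrt (real CARD('n)) * B * norm v" for i
    proof -
      have "norm ((H *v v) $ i) \<le> (\<Sum>j\<in>UNIV. B * norm (v $ j))"
        using assms by (auto simp: matrix_vector_mult_def norm_mult intro!: order_trans[OF norm_sum] sum_mono mult_right_mono)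
      also have "\<dots> = B * (\<Sum>j\<in>UNIV. \<bar>1\<bar> * \<bar>norm (v $ j)\<bar>)" by (simp add: sum_distrib_left)
      also have "\<dots> \<le> B * (sqrt (real CARD('n)) * norm v)"
        using L2_set_mult_ineq[of "\<lambda>_. 1" "\<lambda>j. norm (v $ j)" "UNIV::'n set"] B
        by (intro mult_left_mono) (auto simp: norm_vec_def L2_set_def)
      finally show ?thesis by (simp add: mult_ac)
    qed
    have "norm (H *v v) \<le> L2_set (\<lambda>i::'n. sqrt (real CARD('n)) * B * norm v) UNIV"
      unfolding norm_vec_def[of "H *v v"] by (intro L2_set_mono row) auto
    also have "\<dots> = real CARD('n) * B * norm v"
      using B by (simp add: L2_set_def power_mult_distrib real_sqrt_mult)
    finally show "norm (H *v v) \<le> real CARD('n) * B * norm v" .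
  qed (use B in auto)
qed

lemma norm_vec_le_sqrt_card:
  fixes w :: "'b::real_normed_vector^'n"
  assumes "\<And>i. norm (w $ i) \<le> B" shows "norm w \<le> sqrt (real CARD('n)) * B"
proof -
  have B: "0 \<le> B" using assms[of undefined] norm_ge_zero order_trans by blast
  have "norm w \<le> L2_set (\<lambda>i::'n. B) UNIV"
    unfolding norm_vec_def by (intro L2_set_mono assms) auto
  then show ?thesis using B by (simp add: L2_set_def real_sqrt_mult)
qed

lemma finite_multi_index_order: "finite {\<alpha> :: 'n::finite \<Rightarrow> nat. multi_index_order \<alpha> = k}"
proof (rule finite_subset)
  show "{\<alpha> :: 'n \<Rightarrow> nat. multi_index_order \<alpha> = k} \<subseteq> PiE UNIV (\<lambda>_. {..k})"
    by (auto simp: multi_index_order_def intro: member_le_sum)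
qed (auto intro: finite_PiE)

lemma multi_index_order_count_list: "multi_index_order (count_list is) = length is"
  unfolding multi_index_order_def by (rule sum_count_set) auto

text \<open>The order of differentiation chosen by \<^const>\<open>multi_deriv\<close> is unknown; only the multiset of the
  indices is determined.\<close>

lemma multi_deriv_count_list:
  obtains js where "mset js = mset is" "multi_deriv (count_list is) f = foldr partial_deriv js f"
proof -
  define js where "js = (SOME js. \<forall>i. count_list js i = count_list is i)"
  have "\<forall>i. count_list js i = count_list is i" unfolding js_def by (rule someI[of _ "is"]) simp
  then have "mset js = mset is" by (intro multiset_eqI) (simp add: count_mset)
  then show thesis by (rule that) (simp add: multi_deriv_def js_def)
qed

lemma norm_gradient_component_le_Max:
  "cmod (gradient f x $ i) \<le> (MAX \<alpha>\<in>{\<alpha>. multi_index_order \<alpha> = 1}. cmod (multi_deriv \<alpha> f x))"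
proof -
  obtain js where js: "mset js = mset [i]" "multi_deriv (count_list [i]) f = foldr partial_deriv js f"
    by (rule multi_deriv_count_list)
  then have "js = [i]" by simp
  with js have "gradient f x $ i = multi_deriv (count_list [i]) f x" by (simp add: gradient_def)
  then show ?thesis
    using finite_multi_index_order multi_index_order_count_list[of "[i]"] by (intro Max_ge) auto
qed

lemma gradient_derivative:
  fixes f :: "real^'n \<Rightarrow> complex"
  assumes "gradient f differentiable (at x)"
  obtains G where "(gradient f has_derivative G) (at x)"
    "\<And>i j. hessian f x $ i $ j = G (axis i 1) $ j"
    "\<And>j. ((\<lambda>y. gradient f y $ j) has_derivative (\<lambda>v. G v $ j)) (at x)"
proof -
  obtain G where G: "(gradient f has_derivative G) (at x)" using assms by (auto simp: differentiable_def)
  have c: "((\<lambda>y. gradient f y $ j) has_derivative (\<lambda>v. G v $ j)) (at x)" for j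
    using bounded_linear.has_derivative[OF bounded_linear_vec_nth G] .
  then have "hessian f x $ i $ j = G (axis i 1) $ j" for i j
    using partial_deriv_eq[OF c] by (simp add: hessian_def gradient_def)
  with G c that show thesis by blast
qed

text \<open>This bounds the derivative of the gradient by the Hessian, hence \<open>\<L>\<^sub>1\<close> by the supremum of
  \<open>\<parallel>Hf\<parallel>\<close>.\<close>

lemma norm_gradient_derivative_le:
  fixes f :: "real^'n \<Rightarrow> complex"
  assumes "gradient f differentiable (at x)"
  obtains G where "(gradient f has_derivative G) (at x)"
    "\<And>v. norm (G v) \<le> matrix_norm2 (hessian f x) * norm v"
proof -
  obtain G where G: "(gradient f has_derivative G) (at x)"
    "\<And>i j. hessian f x $ i $ j = G (axis i 1) $ j"
    using gradient_derivative[OF assms] by metis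
  have "G v $ j = (\<Sum>i\<in>UNIV. v $ i *\<^sub>R hessian f x $ i $ j)" for v j
    using arg_cong[OF linear_eq_sum_axis[OF has_derivative_linear[OF G(1)], of v], of "\<lambda>w. w $ j"]
    by (simp add: G(2))
  then show thesis using that[OF G(1)] norm_transpose_mult_le by blast
qed

lemma hessian_symmetric:
  fixes f :: "real^'n \<Rightarrow> complex"
  assumes \<Omega>: "open \<Omega>" "x \<in> \<Omega>" and f: "\<And>y. y \<in> \<Omega> \<Longrightarrow> f differentiable (at y)"
    and g: "gradient f differentiable (at x)"
  shows "hessian f x $ i $ j = hessian f x $ j $ i"
proof -
  obtain G where G: "\<And>i j. hessian f x $ i $ j = G (axis i 1) $ j"
    "\<And>j. ((\<lambda>y. gradient f y $ j) has_derivative (\<lambda>v. G v $ j)) (at x)"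
    using gradient_derivative[OF g] by metis
  define F where "F y v = (\<Sum>i\<in>UNIV. v $ i *\<^sub>R gradient f y $ i)" for y v
  have F: "(f has_derivative F y) (at y)" if "y \<in> \<Omega>" for y
    using has_derivative_gradient[OF f[OF that]] by (simp add: F_def[abs_def])
  have "F y (axis k 1) = gradient f y $ k" for y k
    by (simp add: F_def axis_def if_distrib[of "\<lambda>a. a *\<^sub>R _"] cong: if_cong)
  then have "((\<lambda>y. F y (axis k 1)) has_derivative (\<lambda>v. G v $ k)) (at x)" for k
    using G(2)[of k] by simp
  then have "G (axis i 1) $ j = G (axis j 1) $ i"
    using F by (intro second_derivative_symmetric[OF \<Omega>, where f = f and F = F and u = "axis j 1"
          and A = "\<lambda>v. G v $ j" and w = "axis i 1" and B = "\<lambda>v. G v $ i"]) auto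
  then show ?thesis using G(1) by simp
qed

text \<open>A multi-index of order two leaves open which mixed partial derivative it denotes; symmetry of the
  Hessian makes this harmless.\<close>

lemma norm_hessian_le_Max:
  fixes f :: "real^'n \<Rightarrow> complex"
  assumes "open \<Omega>" "x \<in> \<Omega>" "\<And>y. y \<in> \<Omega> \<Longrightarrow> f differentiable (at y)" "gradient f differentiable (at x)"
  shows "cmod (hessian f x $ i $ j) \<le> (MAX \<alpha>\<in>{\<alpha>. multi_index_order \<alpha> = 2}. cmod (multi_deriv \<alpha> f x))"
proof -
  obtain js where js: "mset js = mset [i, j]" "multi_deriv (count_list [i, j]) f = foldr partial_deriv js f"
    by (rule multi_deriv_count_list)
  obtain a b where "js = [a, b]"
    using mset_eq_length[OF js(1)] by (auto simp: length_Suc_conv)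
  with js(1) have "js = [i, j] \<or> js = [j, i]" by (auto simp: add_eq_conv_ex)
  then have "hessian f x $ i $ j = multi_deriv (count_list [i, j]) f x"
    using js(2) hessian_symmetric[OF assms, of i j] by (auto simp: hessian_def)
  then show ?thesis
    using finite_multi_index_order multi_index_order_count_list[of "[i, j]"] by (intro Max_ge) auto
qed

lemma SUP_ennreal_le_scaled:
  assumes "\<And>x. x \<in> S \<Longrightarrow> a x \<le> k * b x" "0 \<le> k" "0 \<le> c"
  shows "ennreal c * (SUP x\<in>S. ennreal (a x)) \<le> ennreal (k * c) * (SUP x\<in>S. ennreal (b x))"
proof -
  have "(SUP x\<in>S. ennreal (a x)) \<le> (SUP x\<in>S. ennreal k * ennreal (b x))"
  proof (rule SUP_mono)
    show "\<exists>y\<in>S. ennreal (a x) \<le> ennreal k * ennreal (b y)" if "x \<in> S" for x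
      using assms that by (intro bexI[of _ x]) (auto simp: ennreal_mult'[symmetric] intro!: ennreal_leI)
  qed
  also have "\<dots> = ennreal k * (SUP x\<in>S. ennreal (b x))" by (simp add: SUP_mult_left_ennreal)
  finally have "ennreal c * (SUP x\<in>S. ennreal (a x)) \<le> ennreal c * (ennreal k * (SUP x\<in>S. ennreal (b x)))"
    by (rule mult_left_mono) simp
  also have "\<dots> = ennreal (k * c) * (SUP x\<in>S. ennreal (b x))"
    using assms by (simp add: ennreal_mult mult_ac)
  finally show ?thesis .
qed

section \<open>The error bounds\<close>

lemma similarity_ifs_ratios:
  assumes "similarity_ifs M s"
  obtains r where "\<And>m. m \<in> {1..M} \<Longrightarrow> 0 < r m" "\<And>m. m \<in> {1..M} \<Longrightarrow> r m < 1"
    "\<And>m x y. m \<in> {1..M} \<Longrightarrow> dist (s m x) (s m y) = r m * dist x y"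
    "\<And>m. m \<in> {1..M} \<Longrightarrow> surj (s m)"
proof -
  have "\<exists>\<rho>>0. \<rho> < 1 \<and> (\<forall>x y. dist (s m x) (s m y) = \<rho> * dist x y) \<and> surj (s m)"
    if "m \<in> {1..M}" for m
  proof -
    have "\<exists>\<rho> A \<delta>. 0 < \<rho> \<and> \<rho> < 1 \<and> orthogonal_matrix A \<and> (\<forall>x. s m x = \<rho> *\<^sub>R (A *v x) + \<delta>)"
      using assms \<open>m \<in> {1..M}\<close> unfolding similarity_ifs_def by (elim conjE) (erule (1) bspec)
    then obtain \<rho> A \<delta> where a: "0 < \<rho>" "\<rho> < 1" "orthogonal_matrix A"
      and sm: "\<forall>x. s m x = \<rho> *\<^sub>R (A *v x) + \<delta>"
      by (elim exE conjE)
    have A: "orthogonal_transformation ((*v) A)"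
      using a(3) by (simp add: orthogonal_transformation_matrix)
    have "dist (s m x) (s m y) = \<rho> * dist x y" for x y
    proof -
      have "s m x - s m y = \<rho> *\<^sub>R (A *v (x - y))"
        by (simp add: sm matrix_vector_mult_diff_distrib scaleR_diff_right)
      then show ?thesis
        using a(1) orthogonal_transformation_norm[OF A] by (simp add: dist_norm)
    qed
    moreover have "surj (s m)"
    proof (rule surjI[where g = "s m" and f = "\<lambda>y. inv ((*v) A) ((1 / \<rho>) *\<^sub>R (y - \<delta>))"])
      fix y show "s m (inv ((*v) A) ((1 / \<rho>) *\<^sub>R (y - \<delta>))) = y"
        using a(1) surj_f_inv_f[OF orthogonal_transformation_surj[OF A]] by (simp add: sm)
    qed
    ultimately show ?thesis using a by blast
  qed
  then obtain r where "\<And>m. m \<in> {1..M} \<Longrightarrow> 0 < r m \<and> r m < 1 \<and>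
      (\<forall>x y. dist (s m x) (s m y) = r m * dist x y) \<and> surj (s m)"
    by metis
  then show thesis by (intro that[of r]) blast+
qed

text \<open>For \<open>h < diam \<Gamma>\<close> the index set is a cut; otherwise it consists of the empty word, whose cell is
  \<open>\<Gamma>\<close>.\<close>

lemma (in self_similar_set) L_index_partition:
  assumes J: "J = {1..M}" and h: "0 < h"
  shows "finite (L_index M s \<Gamma> h)" "L_index M s \<Gamma> h \<subseteq> words" "pairwise (\<parallel>) (L_index M s \<Gamma> h)"
    "\<Gamma> = (\<Union>w\<in>L_index M s \<Gamma> h. cell s \<Gamma> w)"
    "\<And>w. w \<in> L_index M s \<Gamma> h \<Longrightarrow> diameter (cell s \<Gamma> w) \<le> h"
proof -
  let ?L = "L_index M s \<Gamma> h"
  have "finite ?L \<and> ?L \<subseteq> words \<and> pairwise (\<parallel>) ?L \<and> \<Gamma> = (\<Union>w\<in>?L. cell s \<Gamma> w) \<and>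
    (\<forall>w\<in>?L. diameter (cell s \<Gamma> w) \<le> h)"
  proof (cases "h < diameter \<Gamma>")
    case True
    define t where "t = h / diameter \<Gamma>"
    have t: "0 < t" "t < 1" using True h by (auto simp: t_def)
    have "ratio w \<le> t \<longleftrightarrow> diameter (cell s \<Gamma> w) \<le> h" "t < ratio w \<longleftrightarrow> h < diameter (cell s \<Gamma> w)"
      if "w \<in> words" for w
      using True h diameter_cell[OF that] by (auto simp: t_def field_simps)
    moreover have "butlast w \<in> words" if "w \<in> words" for w using that by (auto dest: in_set_butlastD)
    ultimately have L: "?L = cut t"
      using True unfolding L_index_def cut_def J[symmetric] by (auto simp: lists_eq_set)
    have "pairwise (\<parallel>) (cut t)" using cut_parallel by (auto simp: pairwise_def)
    moreover have "\<Gamma> = (\<Union>w\<in>cut t. cell s \<Gamma> w)" using attractor_eq_Union_cut[OF t] .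
    moreover have "\<forall>w\<in>?L. diameter (cell s \<Gamma> w) \<le> h" using True by (auto simp: L_index_def)
    ultimately show ?thesis using finite_cut[OF t(1)] unfolding L by (auto simp: cut_def)
  next
    case False
    then show ?thesis by (simp add: L_index_def)
  qed
  then show "finite ?L" "?L \<subseteq> words" "pairwise (\<parallel>) ?L" "\<Gamma> = (\<Union>w\<in>?L. cell s \<Gamma> w)"
    "\<And>w. w \<in> ?L \<Longrightarrow> diameter (cell s \<Gamma> w) \<le> h" by blast+
qed

lemma norm_diff_convex_hull_le:
  fixes S :: "'a::euclidean_space set"
  assumes "bounded S" "x \<in> S" "y \<in> convex hull S" shows "norm (x - y) \<le> diameter S"
proof -
  have "S \<subseteq> cball x (diameter S)"
    using diameter_bounded_bound[OF assms(1,2)] by auto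
  then have "convex hull S \<subseteq> cball x (diameter S)" by (intro hull_minimal) auto
  with assms(3) show ?thesis by (auto simp: dist_norm)
qed

context self_similar_measure
begin

lemma barycentre_mem_hull:
  assumes w: "w \<in> words" shows "barycentre \<mu> (cell s \<Gamma> w) \<in> convex hull (cell s \<Gamma> w)"
proof (rule barycentre_mem_convex)
  show "closed (convex hull cell s \<Gamma> w)"
    using compact_convex_hull[OF compact_cell[OF w]] by (rule compact_imp_closed)
qed (use w measure_cell_pos cell_borel in
  \<open>auto simp: finite_\<mu> sets_\<mu> hull_subset intro!: set_integrable_cell continuous_on_id\<close>)

context
  fixes L :: "nat list set" and h :: real and f :: "real^'n \<Rightarrow> complex"
  assumes L: "finite L" "L \<subseteq> words" "pairwise (\<parallel>) L" "\<Gamma> = (\<Union>w\<in>L. cell s \<Gamma> w)"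
    and diam: "\<And>w. w \<in> L \<Longrightarrow> diameter (cell s \<Gamma> w) \<le> h"
    and h: "0 < h"
    and f: "continuous_on \<Gamma> f"
begin

lemma norm_diff_barycentre_le:
  assumes "w \<in> L" "x \<in> cell s \<Gamma> w" shows "norm (x - barycentre \<mu> (cell s \<Gamma> w)) \<le> h"
proof -
  have "w \<in> words" using assms L(2) by auto
  then show ?thesis
    using norm_diff_convex_hull_le[OF compact_imp_bounded[OF compact_cell] assms(2) barycentre_mem_hull]
      diam[OF assms(1)] by (metis order_trans)
qed

text \<open>Here \<open>S w\<close> is an extended Lipschitz constant of \<open>f\<close> near the cell of \<open>w\<close>. If the maximum is
  \<open>\<infinity>\<close>, so is the right-hand side, because \<open>c\<close> and \<open>\<mu>(\<Gamma>)\<close> are positive; otherwise all remainders have a common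
  real bound.\<close>

lemma error_le_of_remainder:
  fixes S :: "nat list \<Rightarrow> ennreal"
  assumes c: "0 < c"
    and rem: "\<And>w B. w \<in> L \<Longrightarrow> S w \<le> ennreal B \<Longrightarrow> 0 \<le> B \<Longrightarrow> \<exists>D::real^'n \<Rightarrow> complex. bounded_linear D \<and>
      (\<forall>x\<in>cell s \<Gamma> w. norm (f x - f (barycentre \<mu> (cell s \<Gamma> w)) - D (x - barycentre \<mu> (cell s \<Gamma> w))) \<le> c * B)"
  shows "ennreal (norm ((LINT x:\<Gamma>|\<mu>. f x) - (\<Sum>w\<in>L. complex_of_real (measure \<mu> (cell s \<Gamma> w)) *
      f (barycentre \<mu> (cell s \<Gamma> w))))) \<le> ennreal (c * measure \<mu> \<Gamma>) * (MAX w\<in>L. S w)"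
proof (cases "MAX w\<in>L. S w")
  case (real B)
  have "S w \<le> ennreal B" if "w \<in> L" for w
    unfolding real(2)[symmetric] using L(1) that by (intro Max_ge) auto
  then have "norm ((LINT x:\<Gamma>|\<mu>. f x) - (\<Sum>w\<in>L. complex_of_real (measure \<mu> (cell s \<Gamma> w)) *
      f (barycentre \<mu> (cell s \<Gamma> w)))) \<le> c * B * measure \<mu> \<Gamma>"
    using rem real(1) by (intro error_le_linear_remainder[OF L f]) auto
  also have "\<dots> = c * measure \<mu> \<Gamma> * B" by simp
  finally show ?thesis
    unfolding real(2) using real(1) c by (subst ennreal_mult[symmetric]) (auto intro!: ennreal_leI)
next
  case top
  have nz: "ennreal (c * measure \<mu> \<Gamma>) \<noteq> 0" using c measure_attractor(2) by simp
  show ?thesis unfolding top ennreal_top_mult_left[OF nz] by (rule top_greatest)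
qed

lemma error_le_lip0:
  "ennreal (norm ((LINT x:\<Gamma>|\<mu>. f x) - (\<Sum>w\<in>L. complex_of_real (measure \<mu> (cell s \<Gamma> w)) *
      f (barycentre \<mu> (cell s \<Gamma> w))))) \<le> ennreal (h * measure \<mu> \<Gamma>) * (MAX w\<in>L. lip0 (convex hull (cell s \<Gamma> w)) f)"
proof (rule error_le_of_remainder[OF h])
  fix w B assume w: "w \<in> L" and B: "lip0 (convex hull (cell s \<Gamma> w)) f \<le> ennreal B" "0 \<le> B"
  have "norm (f x - f (barycentre \<mu> (cell s \<Gamma> w))) \<le> h * B" if x: "x \<in> cell s \<Gamma> w" for x
  proof -
    have "norm (f x - f (barycentre \<mu> (cell s \<Gamma> w))) \<le> B * norm (x - barycentre \<mu> (cell s \<Gamma> w))"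
      using w L(2) x by (intro lip0_boundD[OF B] barycentre_mem_hull hull_inc) auto
    also have "\<dots> \<le> B * h" using norm_diff_barycentre_le[OF w x] B(2) by (rule mult_left_mono)
    finally show ?thesis by (simp add: mult.commute)
  qed
  then show "\<exists>D::real^'n \<Rightarrow> complex. bounded_linear D \<and>
      (\<forall>x\<in>cell s \<Gamma> w. norm (f x - f (barycentre \<mu> (cell s \<Gamma> w)) - D (x - barycentre \<mu> (cell s \<Gamma> w))) \<le> h * B)"
    by (intro exI[of _ "\<lambda>_. 0"]) simp
qed

lemma error_le_lip1:
  assumes d: "\<And>w y. w \<in> L \<Longrightarrow> y \<in> convex hull (cell s \<Gamma> w) \<Longrightarrow> f differentiable (at y)"
  shows "ennreal (norm ((LINT x:\<Gamma>|\<mu>. f x) - (\<Sum>w\<in>L. complex_of_real (measure \<mu> (cell s \<Gamma> w)) *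
      f (barycentre \<mu> (cell s \<Gamma> w))))) \<le> ennreal (h\<^sup>2 / 2 * measure \<mu> \<Gamma>) * (MAX w\<in>L. lip1 (convex hull (cell s \<Gamma> w)) f)"
proof (rule error_le_of_remainder)
  show "0 < h\<^sup>2 / 2" using h by simp
  fix w B assume w: "w \<in> L" and B: "lip1 (convex hull (cell s \<Gamma> w)) f \<le> ennreal B" "0 \<le> B"
  let ?b = "barycentre \<mu> (cell s \<Gamma> w)"
  let ?D = "\<lambda>v. \<Sum>i\<in>UNIV. v $ i *\<^sub>R gradient f ?b $ i"
  have b: "?b \<in> convex hull (cell s \<Gamma> w)" using w L(2) by (intro barycentre_mem_hull) auto
  have "norm (f x - f ?b - ?D (x - ?b)) \<le> h\<^sup>2 / 2 * B" if x: "x \<in> cell s \<Gamma> w" for x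
  proof -
    have "norm (f x - f ?b - ?D (x - ?b)) \<le> B / 2 * (norm (x - ?b))\<^sup>2"
      using b x d[OF w] by (intro taylor_remainder_lip1[OF _ _ _ _ B]) (auto intro: hull_inc)
    also have "\<dots> \<le> B / 2 * h\<^sup>2"
      using norm_diff_barycentre_le[OF w x] B(2) by (intro mult_left_mono power_mono) auto
    finally show ?thesis by (simp add: mult.commute)
  qed
  moreover have "bounded_linear ?D"
    using has_derivative_gradient[OF d[OF w b]] by (rule has_derivative_bounded_linear)
  ultimately show "\<exists>D::real^'n \<Rightarrow> complex. bounded_linear D \<and>
      (\<forall>x\<in>cell s \<Gamma> w. norm (f x - f ?b - D (x - ?b)) \<le> h\<^sup>2 / 2 * B)" by blast
qed

end

end

theorem theorem3p6:
  fixes M :: nat and s :: "nat \<Rightarrow> real^'n \<Rightarrow> real^'n" and \<Gamma> :: "(real^'n) set"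
    and p :: "nat \<Rightarrow> real" and \<mu> :: "(real^'n) measure"
    and h :: real and f :: "real^'n \<Rightarrow> complex"
  defines "L \<equiv> L_index M s \<Gamma> h"
    and "H \<equiv> hull_union M s \<Gamma> h"
    and "E \<equiv> ennreal (cmod ((LINT x:\<Gamma>|\<mu>. f x) - barycentre_rule M s \<Gamma> \<mu> h f))"
  assumes ifs: "similarity_ifs M s"
    and attr: "is_attractor M s \<Gamma>"
    and osc: "open_set_condition M s"
    and weights: "\<And>m. m \<in> {1..M} \<Longrightarrow> 0 < p m \<and> p m < 1" "(\<Sum>m=1..M. p m) = 1"
    and inv: "invariant_measure M s p \<Gamma> \<mu>"
    and h: "h > 0"
    and cont: "continuous_on \<Gamma> f"
  shows
    "E \<le> ennreal (h * measure \<mu> \<Gamma>) * (MAX ms\<in>L. lip0 (convex hull (cell s \<Gamma> ms)) f)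
     \<and>
     (\<forall>\<Omega>. open \<Omega> \<and> H \<subseteq> \<Omega> \<and> f differentiable_on \<Omega> \<longrightarrow>
        E \<le> ennreal (h * measure \<mu> \<Gamma>) * (SUP x\<in>H. ennreal (norm (gradient f x)))
        \<and> ennreal (h * measure \<mu> \<Gamma>) * (SUP x\<in>H. ennreal (norm (gradient f x)))
            \<le> ennreal (sqrt (real CARD('n)) * h * measure \<mu> \<Gamma>) *
              (SUP x\<in>H. ennreal (MAX \<alpha>\<in>{\<alpha>. multi_index_order \<alpha> = 1}. cmod (multi_deriv \<alpha> f x)))
        \<and> E \<le> ennreal (h\<^sup>2 * measure \<mu> \<Gamma>) * (MAX ms\<in>L. lip1 (convex hull (cell s \<Gamma> ms)) f))
     \<and>
     (\<forall>\<Omega>. open \<Omega> \<and> H \<subseteq> \<Omega> \<and> twice_differentiable_on f \<Omega> \<longrightarrow>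
        E \<le> ennreal (h\<^sup>2 / 2 * measure \<mu> \<Gamma>) * (SUP x\<in>H. ennreal (matrix_norm2 (hessian f x)))
        \<and> ennreal (h\<^sup>2 / 2 * measure \<mu> \<Gamma>) * (SUP x\<in>H. ennreal (matrix_norm2 (hessian f x)))
            \<le> ennreal (real CARD('n) * h\<^sup>2 / 2 * measure \<mu> \<Gamma>) *
              (SUP x\<in>H. ennreal (MAX \<alpha>\<in>{\<alpha>. multi_index_order \<alpha> = 2}. cmod (multi_deriv \<alpha> f x))))"
proof -
  obtain r where r: "\<And>m. m \<in> {1..M} \<Longrightarrow> 0 < r m" "\<And>m. m \<in> {1..M} \<Longrightarrow> r m < 1"
    "\<And>m x y. m \<in> {1..M} \<Longrightarrow> dist (s m x) (s m y) = r m * dist x y"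
    "\<And>m. m \<in> {1..M} \<Longrightarrow> surj (s m)"
    using similarity_ifs_ratios[OF ifs] by blast
  have U: "\<exists>U. open U \<and> U \<noteq> {} \<and> (\<forall>m\<in>{1..M}. s m ` U \<subseteq> U) \<and>
      (\<forall>m\<in>{1..M}. \<forall>m'\<in>{1..M}. m \<noteq> m' \<longrightarrow> s m ` U \<inter> s m' ` U = {})"
    using osc unfolding open_set_condition_def UN_subset_iff
    by (elim exE conjE) (rule exI, intro conjI, assumption+)
  have inv': "sets \<mu> = sets borel" "finite_measure \<mu>" "emeasure \<mu> UNIV \<noteq> 0" "emeasure \<mu> (- \<Gamma>) = 0"
    "\<forall>A\<in>sets borel. measure \<mu> A = (\<Sum>m=1..M. p m * measure \<mu> (s m -` A))"
    using inv unfolding invariant_measure_def by fast+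
  interpret finite_measure \<mu> by (fact inv')
  interpret self_similar_measure "{1..M}" s r \<Gamma> p \<mu>
  proof
    show "{1..M} \<noteq> {}" using ifs by (simp add: similarity_ifs_def)
    show "compact \<Gamma>" "\<Gamma> \<noteq> {}" "\<Gamma> = (\<Union>m\<in>{1..M}. s m ` \<Gamma>)"
      using attr unfolding is_attractor_def by blast+
    show "sets \<mu> = sets borel" "emeasure \<mu> UNIV \<noteq> 0" "emeasure \<mu> (- \<Gamma>) = 0"
      by (fact inv')+
    show "measure \<mu> A = (\<Sum>m=1..M. p m * measure \<mu> (s m -` A))" if "A \<in> sets borel" for A
      using inv'(5) that by (rule bspec)
  qed (fact U r weights(2) finite_atLeastAtMost conjunct1[OF weights(1)])+
  note L = L_index_partition[OF refl h, folded L_def]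
  have H: "convex hull (cell s \<Gamma> w) \<subseteq> H" if "w \<in> L" for w
    using that unfolding H_def hull_union_def L_def by blast
  have ne: "L \<noteq> {}" using L(4) attractor_nonempty by auto
  have E: "E = ennreal (norm ((LINT x:\<Gamma>|\<mu>. f x) - (\<Sum>w\<in>L. complex_of_real (measure \<mu> (cell s \<Gamma> w)) *
      f (barycentre \<mu> (cell s \<Gamma> w)))))"
    by (simp add: E_def barycentre_rule_def L_def)
  have lip0: "E \<le> ennreal (h * measure \<mu> \<Gamma>) * (MAX w\<in>L. lip0 (convex hull (cell s \<Gamma> w)) f)"
    unfolding E by (rule error_le_lip0[OF L h cont])
  have lip1: "E \<le> ennreal (h\<^sup>2 / 2 * measure \<mu> \<Gamma>) * (MAX w\<in>L. lip1 (convex hull (cell s \<Gamma> w)) f)"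
    if "H \<subseteq> \<Omega>" "\<And>y. y \<in> \<Omega> \<Longrightarrow> f differentiable (at y)" for \<Omega>
    unfolding E
    by (intro error_le_lip1[OF L h cont] that(2) subsetD[OF that(1)])
      (rule subsetD[OF H] | assumption)+
  have Max_le: "(MAX w\<in>L. S w) \<le> T" if "\<And>w. w \<in> L \<Longrightarrow> S w \<le> T" for S :: "nat list \<Rightarrow> ennreal" and T
    using L(1) ne that by (intro Max.boundedI) auto
  have once: "E \<le> ennreal (h * measure \<mu> \<Gamma>) * (SUP x\<in>H. ennreal (norm (gradient f x)))"
      "ennreal (h * measure \<mu> \<Gamma>) * (SUP x\<in>H. ennreal (norm (gradient f x)))
        \<le> ennreal (sqrt (real CARD('n)) * h * measure \<mu> \<Gamma>) *
          (SUP x\<in>H. ennreal (MAX \<alpha>\<in>{\<alpha>. multi_index_order \<alpha> = 1}. cmod (multi_deriv \<alpha> f x)))"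
      "E \<le> ennreal (h\<^sup>2 * measure \<mu> \<Gamma>) * (MAX w\<in>L. lip1 (convex hull (cell s \<Gamma> w)) f)"
    if \<Omega>: "open \<Omega>" "H \<subseteq> \<Omega>" "f differentiable_on \<Omega>" for \<Omega>
  proof -
    have d: "f differentiable (at y)" if "y \<in> \<Omega>" for y
      using \<Omega> that by (simp add: differentiable_on_eq_differentiable_at)
    have grad_le: "norm (\<Sum>i\<in>UNIV. v $ i *\<^sub>R gradient f x $ i) \<le> norm (gradient f x) * norm v" for x v
      using norm_sum_scaleR_le[of v "gradient f x"] by (simp add: mult.commute)
    have "lip0 (convex hull (cell s \<Gamma> w)) f \<le> (SUP x\<in>H. ennreal (norm (gradient f x)))" if "w \<in> L" for w
      using H[OF that] d \<Omega>(2) grad_le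
      by (intro lip0_le_SUP_derivative[where g' = "\<lambda>x v. \<Sum>i\<in>UNIV. v $ i *\<^sub>R gradient f x $ i"]
          has_derivative_gradient) auto
    then show "E \<le> ennreal (h * measure \<mu> \<Gamma>) * (SUP x\<in>H. ennreal (norm (gradient f x)))"
      by (intro order_trans[OF lip0] mult_left_mono Max_le) auto
    show "ennreal (h * measure \<mu> \<Gamma>) * (SUP x\<in>H. ennreal (norm (gradient f x)))
        \<le> ennreal (sqrt (real CARD('n)) * h * measure \<mu> \<Gamma>) *
          (SUP x\<in>H. ennreal (MAX \<alpha>\<in>{\<alpha>. multi_index_order \<alpha> = 1}. cmod (multi_deriv \<alpha> f x)))"
      unfolding mult.assoc using h
      by (intro SUP_ennreal_le_scaled norm_vec_le_sqrt_card norm_gradient_component_le_Max) simp_all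
    have "ennreal (h\<^sup>2 / 2 * measure \<mu> \<Gamma>) \<le> ennreal (h\<^sup>2 * measure \<mu> \<Gamma>)"
      by (intro ennreal_leI mult_right_mono) auto
    then show "E \<le> ennreal (h\<^sup>2 * measure \<mu> \<Gamma>) * (MAX w\<in>L. lip1 (convex hull (cell s \<Gamma> w)) f)"
      using d by (intro order_trans[OF lip1[OF \<Omega>(2)]] mult_right_mono) auto
  qed
  have twice: "E \<le> ennreal (h\<^sup>2 / 2 * measure \<mu> \<Gamma>) * (SUP x\<in>H. ennreal (matrix_norm2 (hessian f x)))"
      "ennreal (h\<^sup>2 / 2 * measure \<mu> \<Gamma>) * (SUP x\<in>H. ennreal (matrix_norm2 (hessian f x)))
        \<le> ennreal (real CARD('n) * h\<^sup>2 / 2 * measure \<mu> \<Gamma>) *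
          (SUP x\<in>H. ennreal (MAX \<alpha>\<in>{\<alpha>. multi_index_order \<alpha> = 2}. cmod (multi_deriv \<alpha> f x)))"
    if \<Omega>: "open \<Omega>" "H \<subseteq> \<Omega>" "twice_differentiable_on f \<Omega>" for \<Omega>
  proof -
    have d: "f differentiable (at y)" and g: "gradient f differentiable (at y)" if "y \<in> \<Omega>" for y
      using \<Omega> that by (simp_all add: twice_differentiable_on_def differentiable_on_eq_differentiable_at)
    have "lip1 (convex hull (cell s \<Gamma> w)) f \<le> (SUP x\<in>H. ennreal (matrix_norm2 (hessian f x)))"
      if w: "w \<in> L" for w
    proof -
      have "\<exists>G. (gradient f has_derivative G) (at x) \<and>
          (\<forall>v. norm (G v) \<le> matrix_norm2 (hessian f x) * norm v)" if "x \<in> \<Omega>" for x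
        using norm_gradient_derivative_le[OF g[OF that]] by blast
      then obtain G where "\<And>x. x \<in> \<Omega> \<Longrightarrow> (gradient f has_derivative G x) (at x)"
        "\<And>x v. x \<in> \<Omega> \<Longrightarrow> norm (G x v) \<le> matrix_norm2 (hessian f x) * norm v"
        by metis
      moreover have "0 \<le> matrix_norm2 (hessian f x)" for x
        unfolding matrix_norm2_def by (intro onorm_pos_le) auto
      moreover have "convex hull (cell s \<Gamma> w) \<subseteq> \<Omega>" using H[OF w] \<Omega>(2) by blast
      ultimately show ?thesis
        unfolding lip1_def using H[OF w] by (intro lip0_le_SUP_derivative[where g' = G]) auto
    qed
    then show "E \<le> ennreal (h\<^sup>2 / 2 * measure \<mu> \<Gamma>) * (SUP x\<in>H. ennreal (matrix_norm2 (hessian f x)))"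
      using d by (intro order_trans[OF lip1[OF \<Omega>(2)]] mult_left_mono Max_le) auto
    have entries: "matrix_norm2 (hessian f x) \<le>
        real CARD('n) * (MAX \<alpha>\<in>{\<alpha>. multi_index_order \<alpha> = 2}. cmod (multi_deriv \<alpha> f x))" if "x \<in> H" for x
      using that \<Omega>(1,2) d g by (intro matrix_norm2_le norm_hessian_le_Max[of \<Omega>]) auto
    have eq: "real CARD('n) * h\<^sup>2 / 2 * measure \<mu> \<Gamma> = real CARD('n) * (h\<^sup>2 / 2 * measure \<mu> \<Gamma>)" by simp
    show "ennreal (h\<^sup>2 / 2 * measure \<mu> \<Gamma>) * (SUP x\<in>H. ennreal (matrix_norm2 (hessian f x)))
        \<le> ennreal (real CARD('n) * h\<^sup>2 / 2 * measure \<mu> \<Gamma>) *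
          (SUP x\<in>H. ennreal (MAX \<alpha>\<in>{\<alpha>. multi_index_order \<alpha> = 2}. cmod (multi_deriv \<alpha> f x)))"
      unfolding eq by (rule SUP_ennreal_le_scaled) (use entries in auto)
  qed
  show ?thesis using lip0 once twice by blast
qed

end
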